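(* Let $(l_1,\dots,l_m)$ be the (non-increasing) segment sequence of some unicyclic graph with $l_1\leq 2$, and let $H\in \mathbb{U}(l_1,\dots,l_m)$. (i) If $l_1=2$ and $m\geq 4$, then $n(H)\leq n(U_{l_1,l_2}(l_3,\dots,l_{m-1};l_m))$. (ii) If $l_1=1$ and $m\geq 6$, then $n(H)\leq n(U^1_m)$.
   Context: A unicyclic graph is a connected graph containing exactly one cycle. A segment of a graph $G$ is a path whose end vertices each have degree $1$ or at least $3$ in $G$ and whose internal vertices all have degree $2$ in $G$; its length is its number of edges. The segment sequence of $G$ is the non-increasing sequence of segment lengths of $G$, and $\mathbb{U}(l_1,\dots,l_m)$ is the set of unicyclic graphs with segment sequence $(l_1,\dots,l_m)$. A pendent path of length $\ell$ attached at a vertex $w$ consists of $\ell$ new vertices $x_1,\dots,x_\ell$ and edges $wx_1,x_1x_2,\dots,x_{\ell-1}x_\ell$. For positive integers $a,b$ with $a+b\ge 3$ and lists $s_1,\dots,s_t$ and $r_1,\dots,r_q$ (both nonempty), $U_{a,b}(s_1,\dots,s_t;r_1,\dots,r_q)$ is the graph obtained from the cycle $C_{a+b}$ by choosing two vertices $x,y$ that split the cycle into two paths of lengths $a$ and $b$, attaching pendent paths of lengths $s_1,\dots,s_t$ at $x$ and pendent paths of lengths $r_1,\dots,r_q$ at $y$ (so that its segment sequence consists of $a,b,s_1,\dots,s_t,r_1,\dots,r_q$). $U^1_n$ is the graph obtained from the triangle $C_3$ by attaching one pendent vertex to each of two of its vertices and $n-5$ pendent vertices to the third vertex. A subtree of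 a graph is a subgraph that is a tree (distinguished as subgraphs); $n(G)$ is the number of subtrees of $G$, counting also the empty subtree.
   Formalization: A segment's two ends may coincide, so a cycle with just one vertex of degree at least 3 counts as one segment; with segments read strictly as paths the claim fails, e.g. for a triangle with pendent paths of lengths 2,2,1,1 at one vertex (228 subtrees against 45). *)

theory Defs
  imports "HOL-Library.Multiset"
begin

definition simple_graph :: "'a set \<Rightarrow> 'a set set \<Rightarrow> bool" where
  "simple_graph V E \<longleftrightarrow> finite V \<and>
     (\<forall>e\<in>E. \<exists>u v. e = {u, v} \<and> u \<noteq> v \<and> u \<in> V \<and> v \<in> V)"

definition adj :: "'a set set \<Rightarrow> 'a \<Rightarrow> 'a \<Rightarrow> bool" where
  "adj E u v \<longleftrightarrow> {u, v} \<in> E"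

definition connected_graph :: "'a set \<Rightarrow> 'a set set \<Rightarrow> bool" where
  "connected_graph V E \<longleftrightarrow> V \<noteq> {} \<and> (\<forall>u\<in>V. \<forall>v\<in>V. (adj E)\<^sup>*\<^sup>* u v)"

definition degree :: "'a set set \<Rightarrow> 'a \<Rightarrow> nat" where
  "degree E v = card {e\<in>E. v \<in> e}"

definition is_cycle :: "'a set set \<Rightarrow> bool" where
  "is_cycle C \<longleftrightarrow> (\<exists>vs. length vs \<ge> 3 \<and> distinct vs \<and>
      C = {{vs ! i, vs ! ((i + 1) mod length vs)} | i. i < length vs})"

definition cycles :: "'a set set \<Rightarrow> 'a set set set" where
  "cycles E = {C. C \<subseteq> E \<and> is_cycle C}"

definition unicyclic :: "'a set \<Rightarrow> 'a set set \<Rightarrow> bool" where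
  "unicyclic V E \<longleftrightarrow> simple_graph V E \<and> connected_graph V E \<and> card (cycles E) = 1"

definition is_tree :: "'a set \<Rightarrow> 'a set set \<Rightarrow> bool" where
  "is_tree V E \<longleftrightarrow> connected_graph V E \<and> cycles E = {}"

definition subtrees :: "'a set \<Rightarrow> 'a set set \<Rightarrow> ('a set \<times> 'a set set) set" where
  "subtrees V E = {(V', E'). V' \<subseteq> V \<and> E' \<subseteq> E \<and> (\<forall>e\<in>E'. e \<subseteq> V') \<and> is_tree V' E'}"

text \<open>n(G): number of subtrees, counting also the empty subtree.\<close>
definition num_subtrees :: "'a set \<Rightarrow> 'a set set \<Rightarrow> nat" where
  "num_subtrees V E = card (subtrees V E) + 1"

text \<open>A segment, given as its edge set: a path v_0 \<dots> v_k (k \<ge> 1) whose internal vertices are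
  pairwise distinct, distinct from the ends, and of degree 2, and whose end vertices have degree
  1 or at least 3. The two ends may coincide (a cycle hanging at a single branch vertex).\<close>
definition segment :: "'a set \<Rightarrow> 'a set set \<Rightarrow> 'a set set \<Rightarrow> bool" where
  "segment V E S \<longleftrightarrow> (\<exists>p. length p \<ge> 2 \<and> set p \<subseteq> V \<and>
      (\<forall>i. i + 1 < length p \<longrightarrow> {p ! i, p ! (i+1)} \<in> E) \<and>
      distinct (butlast (tl p)) \<and> hd p \<notin> set (butlast (tl p)) \<and> last p \<notin> set (butlast (tl p)) \<and>
      (\<forall>v\<in>set (butlast (tl p)). degree E v = 2) \<and>
      (degree E (hd p) = 1 \<or> degree E (hd p) \<ge> 3) \<and>
      (degree E (last p) = 1 \<or> degree E (last p) \<ge> 3) \<and>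
      S = {{p ! i, p ! (i+1)} | i. i + 1 < length p} \<and>
      card S = length p - 1)"

definition segment_length :: "'a set set \<Rightarrow> nat" where
  "segment_length S = card S"

definition segment_sequence :: "'a set \<Rightarrow> 'a set set \<Rightarrow> nat multiset" where
  "segment_sequence V E = image_mset segment_length (mset_set {S. segment V E S})"

definition U_seq :: "nat list \<Rightarrow> ('a set \<times> 'a set set) set" where
  "U_seq l = {(V, E). unicyclic V E \<and> segment_sequence V E = mset l}"

text \<open>The graph U_{a,b}(s_1..s_t; r_1..r_q): cycle vertices Cyc 0 .. Cyc (a+b-1), x = Cyc 0,
  y = Cyc a; PX j k is the k-th vertex (1 \<le> k \<le> s_j) of the j-th pendent path at x, PY likewise at y.\<close>
datatype uvert = Cyc nat | PX nat nat | PY nat nat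

definition Uab_V :: "nat \<Rightarrow> nat \<Rightarrow> nat list \<Rightarrow> nat list \<Rightarrow> uvert set" where
  "Uab_V a b ss rs = Cyc ` {..<a+b}
     \<union> {PX j k | j k. j < length ss \<and> 1 \<le> k \<and> k \<le> ss ! j}
     \<union> {PY j k | j k. j < length rs \<and> 1 \<le> k \<and> k \<le> rs ! j}"

definition Uab_E :: "nat \<Rightarrow> nat \<Rightarrow> nat list \<Rightarrow> nat list \<Rightarrow> uvert set set" where
  "Uab_E a b ss rs = {{Cyc i, Cyc ((i + 1) mod (a + b))} | i. i < a + b}
     \<union> {{Cyc 0, PX j 1} | j. j < length ss \<and> 1 \<le> ss ! j}
     \<union> {{PX j k, PX j (k + 1)} | j k. j < length ss \<and> 1 \<le> k \<and> k < ss ! j}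
     \<union> {{Cyc a, PY j 1} | j. j < length rs \<and> 1 \<le> rs ! j}
     \<union> {{PY j k, PY j (k + 1)} | j k. j < length rs \<and> 1 \<le> k \<and> k < rs ! j}"

definition U1_V :: "nat \<Rightarrow> nat set" where
  "U1_V n = {..<n}"

definition U1_E :: "nat \<Rightarrow> nat set set" where
  "U1_E n = {{0,1},{1,2},{0,2},{1,3},{2,4}} \<union> {{0, j} | j. 5 \<le> j \<and> j < n}"

end

theory Submission
  imports Defs
begin

text \<open>
  Give the vertices weights and count each subtree with the product of the weights of its vertices.
  Removing a leaf \<open>v\<close> attached at \<open>u\<close> is then exact: the count drops by \<open>f v\<close> if \<open>f u\<close> is replaced by
  \<open>f u * (1 + f v)\<close>. Since the count grows at least as fast as each single weight, this is at most
  the count with \<open>f u\<close> replaced by \<open>2 * f u * f v\<close>, plus 1, which amounts to moving everything that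
  hangs at \<open>v\<close> over to \<open>u\<close>. Removing a pendent path of length 2 likewise costs a factor 3 and a
  summand 3. As the segments have length at most 2, the graph is peeled in this way down to its
  cycle, where the product of the weights is \<open>3 ^ p * 2 ^ q\<close>, the vertices of degree 2 have weight 1
  and all other weights are at least 2. The subtrees of a weighted cycle are its arcs, and their
  weighted number is compared with the exact value for the extremal graph.
\<close>

subsection \<open>Weighted numbers of subtrees\<close>

text \<open>The quantity that makes graphs comparable is a product over all segments. A segment of
  length \<open>s\<close> off the cycle ends up as a factor \<open>s + 1\<close> in the product
  \<open>A\<close> of the cycle weights. If the cycle itself consists of \<open>c2\<close> segments
  of length 2 and \<open>c1\<close> of length 1, then \<open>A * 3 ^ c2 * 2 ^ c1\<close> is the same
  for all graphs with the given segment sequence. A longer cycle gains arcs only linearly, through a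
  bound \<open>K * A\<close>, but loses exponentially in \<open>A\<close>; this disposes of all but
  the shortest cycles. On the extremal cycle \<open>A\<close> is fixed and the count grows with the
  sum of the weights, which is largest when the weights are as unequal as possible. That is why a
  single shortest pendent path hangs at the second attachment vertex, and why two vertices of the
  triangle in the last case carry one pendent vertex each. A peeling step is an equality if the
  outer end has weight 1, so nothing is lost on graphs whose pendent paths all hang directly at the
  cycle, as in the extremal ones. Length at most 2 is what makes vertices of degree 2 pairwise
  nonadjacent, so that the segment sequence can be read off from degrees.\<close>

definition wtrees :: "'a set \<Rightarrow> 'a set set \<Rightarrow> ('a \<Rightarrow> nat) \<Rightarrow> nat" where
  "wtrees V E f = (\<Sum>T\<in>subtrees V E. \<Prod>v\<in>fst T. f v)"

lemma simple_graphD: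
  assumes "simple_graph V E"
  shows "finite V" "finite E" "e \<in> E \<Longrightarrow> e \<subseteq> V"
proof -
  show fV: "finite V" using assms by (simp add: simple_graph_def)
  show sub: "e \<in> E \<Longrightarrow> e \<subseteq> V" for e using assms by (auto simp: simple_graph_def)
  then have "E \<subseteq> Pow V" by blast
  with fV show "finite E" by (meson finite_Pow_iff finite_subset)
qed

lemma finite_subtrees:
  assumes "finite V" "finite E"
  shows "finite (subtrees V E)"
proof (rule finite_subset)
  show "subtrees V E \<subseteq> Pow V \<times> Pow E" by (auto simp: subtrees_def)
  show "finite (Pow V \<times> Pow E)" using assms by simp
qed

lemma num_subtrees_eq_wtrees: "num_subtrees V E = wtrees V E (\<lambda>_. 1) + 1"
  by (simp add: num_subtrees_def wtrees_def)

lemma wtrees_cong: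
  assumes "\<And>v. v \<in> V \<Longrightarrow> f v = g v"
  shows "wtrees V E f = wtrees V E g"
  unfolding wtrees_def by (rule sum.cong[OF refl], rule prod.cong) (use assms in \<open>auto simp: subtrees_def\<close>)

section \<open>Connectivity, cycles and trees when a leaf is added or removed\<close>

lemma adj_sym: "adj E x y \<Longrightarrow> adj E y x"
  by (simp add: adj_def insert_commute)

lemma rtranclp_adj_sym: "(adj E)\<^sup>*\<^sup>* x y \<Longrightarrow> (adj E)\<^sup>*\<^sup>* y x"
  by (induction rule: rtranclp_induct) (auto intro: adj_sym converse_rtranclp_into_rtranclp)

lemma rtranclp_adj_mono: "E \<subseteq> F \<Longrightarrow> (adj E)\<^sup>*\<^sup>* x y \<Longrightarrow> (adj F)\<^sup>*\<^sup>* x y"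
  by (rule rtranclp_mono[THEN predicate2D]) (auto simp: adj_def)

text \<open>Applied directly it confines the vertices of a subtree to a set that no edge leaves;
  contrapositively it produces an edge leaving a given vertex set.\<close>

lemma connected_graph_closed_set:
  assumes "connected_graph V E" "x \<in> V" "x \<in> A"
    and closed: "\<And>e. e \<in> E \<Longrightarrow> e \<inter> A \<noteq> {} \<Longrightarrow> e \<subseteq> A"
  shows "V \<subseteq> A"
proof
  fix y assume "y \<in> V"
  with assms have "(adj E)\<^sup>*\<^sup>* x y" by (auto simp: connected_graph_def)
  then show "y \<in> A"
  proof (induction rule: rtranclp_induct)
    case (step a b)
    then show ?case using closed[of "{a, b}"] by (auto simp: adj_def)
  qed (use assms in auto)
qed

text \<open>The edges before and after a vertex in the cyclic order differ, as there are at least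
  three vertices. Hence an edge at a leaf lies on no cycle, and a cycle vertex of degree 2 has all
  its edges on the cycle.\<close>

lemma is_cycle_two_edges:
  assumes "is_cycle C" "e \<in> C" "x \<in> e"
  obtains e' where "e' \<in> C" "x \<in> e'" "e' \<noteq> e"
proof -
  obtain vs where vs: "length vs \<ge> 3" "distinct vs"
    and C: "C = {{vs ! i, vs ! ((i + 1) mod length vs)} | i. i < length vs}"
    using assms(1) by (auto simp: is_cycle_def)
  define n where "n = length vs"
  obtain i where i: "i < n" "e = {vs ! i, vs ! ((i + 1) mod n)}"
    using assms(2) C by (auto simp: n_def)
  define s where "s j = (j + 1) mod n" for j
  have s: "s j < n" for j using vs by (auto simp: s_def n_def intro: mod_less_divisor)
  have s': "s j = (if j + 1 = n then 0 else j + 1)" if "j < n" for j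
    using that by (auto simp: s_def)
  have inC: "{vs ! j, vs ! s j} \<in> C" if "j < n" for j
    using that C by (auto simp: s_def n_def)
  have inj: "vs ! a = vs ! b \<longleftrightarrow> a = b" if "a < n" "b < n" for a b
    using vs that by (simp add: n_def nth_eq_iff_index_eq)
  have n3: "n \<ge> 3" using vs by (simp add: n_def)
  consider "x = vs ! i" | "x = vs ! s i" using i assms(3) by (auto simp: s_def)
  then show ?thesis
  proof cases
    case 1
    define j where "j = (if i = 0 then n - 1 else i - 1)"
    have j: "j < n" "s j = i" using i n3 s'[of j] by (auto simp: j_def)
    have "{vs ! j, vs ! s j} \<noteq> e"
      unfolding i s_def[symmetric]
      using inj j i s s' n3 by (auto simp: doubleton_eq_iff j_def split: if_splits)
    then show ?thesis using that[OF inC[OF j(1)]] j 1 by auto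
  next
    case 2
    have "{vs ! s i, vs ! s (s i)} \<noteq> e"
      unfolding i s_def[symmetric]
      using inj i s s' n3 by (auto simp: doubleton_eq_iff split: if_splits)
    then show ?thesis using that[OF inC[OF s]] 2 by auto
  qed
qed

lemma cycles_mono: "E \<subseteq> F \<Longrightarrow> cycles E \<subseteq> cycles F"
  by (auto simp: cycles_def)

lemma cycles_add_leaf:
  assumes "v \<notin> \<Union>E" "u \<noteq> v"
  shows "cycles (insert {u, v} E) = cycles E"
proof
  show "cycles E \<subseteq> cycles (insert {u, v} E)" by (rule cycles_mono) auto
  show "cycles (insert {u, v} E) \<subseteq> cycles E"
  proof
    fix C assume C: "C \<in> cycles (insert {u, v} E)"
    have "{u, v} \<notin> C"
    proof
      assume "{u, v} \<in> C"
      moreover have "is_cycle C" using C by (simp add: cycles_def)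
      ultimately obtain e' where "e' \<in> C" "v \<in> e'" "e' \<noteq> {u, v}"
        using is_cycle_two_edges by (metis insertI1 insert_commute)
      with C assms show False by (auto simp: cycles_def)
    qed
    with C show "C \<in> cycles E" by (auto simp: cycles_def)
  qed
qed

lemma connected_graph_add_leaf:
  assumes "connected_graph V E" "u \<in> V"
  shows "connected_graph (insert v V) (insert {u, v} E)"
proof -
  have ru: "(adj (insert {u, v} E))\<^sup>*\<^sup>* u x" if "x \<in> insert v V" for x
  proof (cases "x = v")
    case True
    then show ?thesis by (auto simp: adj_def intro: r_into_rtranclp)
  next
    case False
    then have "(adj E)\<^sup>*\<^sup>* u x" using assms that by (auto simp: connected_graph_def)
    then show ?thesis by (rule rtranclp_adj_mono[rotated]) auto
  qed
  then have "(adj (insert {u, v} E))\<^sup>*\<^sup>* x y" if "x \<in> insert v V" "y \<in> insert v V" for x y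
    using that rtranclp_adj_sym rtranclp_trans by metis
  then show ?thesis by (auto simp: connected_graph_def)
qed

text \<open>The map \<open>r\<close> that sends the leaf \<open>v\<close> to its neighbour
  \<open>u\<close> turns walks into walks: the edge \<open>{u, v}\<close> collapses and every other
  edge is fixed.\<close>

lemma connected_graph_remove_leaf:
  assumes conn: "connected_graph V E" and "u \<in> V" "u \<noteq> v"
    and leaf: "\<And>e. e \<in> E \<Longrightarrow> v \<in> e \<Longrightarrow> e = {u, v}"
  shows "connected_graph (V - {v}) (E - {{u, v}})"
proof -
  define r where "r x = (if x = v then u else x)" for x
  have "(adj (E - {{u, v}}))\<^sup>*\<^sup>* (r x) (r y)" if "(adj E)\<^sup>*\<^sup>* x y" for x y
    using that
  proof (induction rule: rtranclp_induct)
    case (step y z)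
    show ?case
    proof (cases "{y, z} = {u, v}")
      case True
      then have "r y = r z" by (auto simp: r_def doubleton_eq_iff)
      then show ?thesis using step by simp
    next
      case False
      then have "y \<noteq> v" "z \<noteq> v" using step(2) leaf[of "{y, z}"] by (auto simp: adj_def)
      then have "adj (E - {{u, v}}) (r y) (r z)" using step(2) False by (simp add: adj_def r_def)
      then show ?thesis using step by simp
    qed
  qed simp
  then have "(adj (E - {{u, v}}))\<^sup>*\<^sup>* x y" if "x \<in> V - {v}" "y \<in> V - {v}" for x y
    using that conn by (fastforce simp: connected_graph_def r_def)
  then show ?thesis using assms by (auto simp: connected_graph_def)
qed

lemma is_tree_singleton: "is_tree {v} {}"
proof -
  have "cycles ({} :: 'a set set) = {}"
    by (force simp: cycles_def is_cycle_def)
  then show ?thesis by (simp add: is_tree_def connected_graph_def)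
qed

lemma is_tree_add_leaf:
  assumes "is_tree V E" "u \<in> V" "v \<notin> V" "\<And>e. e \<in> E \<Longrightarrow> e \<subseteq> V"
  shows "is_tree (insert v V) (insert {u, v} E)"
  using assms connected_graph_add_leaf[of V E u v] cycles_add_leaf[of v E u]
  by (auto simp: is_tree_def)

lemma simple_graph_add_leaf:
  assumes "simple_graph V E" "u \<in> V" "v \<notin> V"
  shows "simple_graph (insert v V) (insert {u, v} E)"
proof -
  have "u \<noteq> v" using assms by auto
  then show ?thesis using assms unfolding simple_graph_def by blast
qed

text \<open>The only edge at \<open>v\<close> is \<open>{u, v}\<close>. A subtree through
  \<open>v\<close> without this edge is \<open>v\<close> alone by connectivity; one with this edge
  stays a tree when the leaf \<open>v\<close> is cut off.\<close>

lemma subtrees_add_leaf: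
  assumes G: "simple_graph V E" and u: "u \<in> V" and v: "v \<notin> V"
  shows "subtrees (insert v V) (insert {u, v} E) =
    subtrees V E \<union> insert ({v}, {})
      ((\<lambda>T. (insert v (fst T), insert {u, v} (snd T))) ` {T\<in>subtrees V E. u \<in> fst T})"
    (is "?L = ?R")
proof
  have uv: "u \<noteq> v" using u v by auto
  have vE: "v \<notin> e" if "e \<in> E" for e using simple_graphD(3)[OF G that] v by auto
  show "?R \<subseteq> ?L"
  proof
    fix T assume "T \<in> ?R"
    then consider "T \<in> subtrees V E" | "T = ({v}, {})"
      | V' E' where "(V', E') \<in> subtrees V E" "u \<in> V'" "T = (insert v V', insert {u, v} E')" by auto
    then show "T \<in> ?L"
    proof cases
      case 1 then show ?thesis by (auto simp: subtrees_def)
    next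
      case 2 then show ?thesis by (simp add: subtrees_def is_tree_singleton)
    next
      case 3
      then have "is_tree (insert v V') (insert {u, v} E')"
        using v by (intro is_tree_add_leaf) (auto simp: subtrees_def)
      with 3 show ?thesis by (auto simp: subtrees_def)
    qed
  qed
  show "?L \<subseteq> ?R"
  proof
    fix T assume "T \<in> ?L"
    then obtain V' E' where T: "T = (V', E')" and V': "V' \<subseteq> insert v V"
      and E': "E' \<subseteq> insert {u, v} E" and inc: "\<forall>e\<in>E'. e \<subseteq> V'" and tree: "is_tree V' E'"
      by (auto simp: subtrees_def)
    have conn: "connected_graph V' E'" using tree by (simp add: is_tree_def)
    have leaf: "e = {u, v}" if "e \<in> E'" "v \<in> e" for e using that E' vE by auto
    show "T \<in> ?R"
    proof (cases "v \<in> V'")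
      case False
      then have "{u, v} \<notin> E'" using inc by auto
      then have "T \<in> subtrees V E" using False V' E' inc tree T by (auto simp: subtrees_def)
      then show ?thesis by simp
    next
      case vV': True
      show ?thesis
      proof (cases "{u, v} \<in> E'")
        case False
        then have vE': "v \<notin> e" if "e \<in> E'" for e using leaf that by blast
        have "V' \<subseteq> {v}"
          by (rule connected_graph_closed_set[OF conn vV']) (use vE' in auto)
        then have "V' = {v}" using vV' by auto
        moreover have "E' = {}"
        proof (rule ccontr)
          assume "E' \<noteq> {}"
          then obtain e where e: "e \<in> E'" by auto
          then have "e \<in> E" using E' False by auto
          then obtain a b where "e = {a, b}" using G by (auto simp: simple_graph_def)
          then have "a \<in> e" by simp
          then have "a = v" using e inc \<open>V' = {v}\<close> by auto
          then show False using \<open>a \<in> e\<close> vE'[OF e] by simp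
        qed
        ultimately show ?thesis using T by simp
      next
        case True
        then have uV': "u \<in> V'" using inc by auto
        have "connected_graph (V' - {v}) (E' - {{u, v}})"
          by (rule connected_graph_remove_leaf[OF conn uV' uv leaf])
        moreover have "cycles (E' - {{u, v}}) = {}"
          using tree cycles_mono[of "E' - {{u, v}}" E'] unfolding is_tree_def by blast
        ultimately have "(V' - {v}, E' - {{u, v}}) \<in> subtrees V E"
          using V' E' inc leaf unfolding subtrees_def is_tree_def by blast
        moreover have "u \<in> V' - {v}" using uV' uv by simp
        moreover have "T = (insert v (V' - {v}), insert {u, v} (E' - {{u, v}}))"
          using T vV' True by auto
        ultimately show ?thesis using image_eqI[of T "\<lambda>T. (insert v (fst T), insert {u, v} (snd T))" "(V' - {v}, E' - {{u, v}})"]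
          by simp
      qed
    qed
  qed
qed

section \<open>The weighted count as an affine function of a single weight\<close>

lemma wtrees_upd:
  assumes G: "simple_graph V E"
  shows "wtrees V E (f(u := a)) = (\<Sum>T\<in>{T\<in>subtrees V E. u \<notin> fst T}. \<Prod>x\<in>fst T. f x)
    + a * (\<Sum>T\<in>{T\<in>subtrees V E. u \<in> fst T}. \<Prod>x\<in>fst T - {u}. f x)"
proof -
  have fin: "finite (subtrees V E)" using simple_graphD[OF G] finite_subtrees by blast
  have fT: "finite (fst T)" if "T \<in> subtrees V E" for T
    using that finite_subset[OF _ simple_graphD(1)[OF G]] by (auto simp: subtrees_def)
  have "wtrees V E (f(u := a)) = (\<Sum>T\<in>{T\<in>subtrees V E. u \<notin> fst T} \<union> {T\<in>subtrees V E. u \<in> fst T}.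
      \<Prod>x\<in>fst T. (f(u := a)) x)"
    unfolding wtrees_def by (rule sum.cong) auto
  also have "\<dots> = (\<Sum>T\<in>{T\<in>subtrees V E. u \<notin> fst T}. \<Prod>x\<in>fst T. (f(u := a)) x)
      + (\<Sum>T\<in>{T\<in>subtrees V E. u \<in> fst T}. \<Prod>x\<in>fst T. (f(u := a)) x)"
    by (rule sum.union_disjoint) (use fin in auto)
  also have "(\<Sum>T\<in>{T\<in>subtrees V E. u \<notin> fst T}. \<Prod>x\<in>fst T. (f(u := a)) x)
      = (\<Sum>T\<in>{T\<in>subtrees V E. u \<notin> fst T}. \<Prod>x\<in>fst T. f x)"
    by (intro sum.cong prod.cong) auto
  also have "(\<Sum>T\<in>{T\<in>subtrees V E. u \<in> fst T}. \<Prod>x\<in>fst T. (f(u := a)) x)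
      = (\<Sum>T\<in>{T\<in>subtrees V E. u \<in> fst T}. a * (\<Prod>x\<in>fst T - {u}. f x))"
  proof (rule sum.cong[OF refl])
    fix T assume T: "T \<in> {T\<in>subtrees V E. u \<in> fst T}"
    then have "(\<Prod>x\<in>fst T. (f(u := a)) x) = a * (\<Prod>x\<in>fst T - {u}. (f(u := a)) x)"
      using fT by (subst prod.remove[of _ u]) auto
    also have "(\<Prod>x\<in>fst T - {u}. (f(u := a)) x) = (\<Prod>x\<in>fst T - {u}. f x)"
      by (rule prod.cong) auto
    finally show "(\<Prod>x\<in>fst T. (f(u := a)) x) = a * (\<Prod>x\<in>fst T - {u}. f x)" .
  qed
  finally show ?thesis unfolding sum_distrib_left .
qed

text \<open>The slope of the weighted count in a single weight is at least 1, because of the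
  subtree consisting of that vertex only.\<close>
lemma wtrees_upd_mono:
  assumes G: "simple_graph V E" and "u \<in> V" "a \<le> b"
  shows "wtrees V E (f(u := a)) + (b - a) \<le> wtrees V E (f(u := b))"
proof -
  define Y where "Y = (\<Sum>T\<in>{T\<in>subtrees V E. u \<in> fst T}. \<Prod>x\<in>fst T - {u}. f x)"
  have fin: "finite (subtrees V E)" using simple_graphD[OF G] finite_subtrees by blast
  have "({u}, {}) \<in> {T\<in>subtrees V E. u \<in> fst T}"
    using assms by (simp add: subtrees_def is_tree_singleton)
  from member_le_sum[OF this, of "\<lambda>T. \<Prod>x\<in>fst T - {u}. f x"] fin
  have "1 \<le> Y" by (simp add: Y_def)
  then have "(b - a) * 1 \<le> (b - a) * Y" by (rule mult_le_mono2)
  then have "a * Y + (b - a) \<le> b * Y" using assms(3) by (auto simp: diff_mult_distrib le_diff_conv2)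
  then show ?thesis unfolding wtrees_upd[OF G] Y_def[symmetric] by simp
qed

text \<open>Each old subtree through \<open>u\<close> occurs twice, without and with
  \<open>v\<close>, which multiplies its weight by \<open>1 + f v\<close>; the summand is the
  subtree consisting of \<open>v\<close> only.\<close>

lemma wtrees_add_leaf:
  assumes G: "simple_graph V E" and u: "u \<in> V" and v: "v \<notin> V"
  shows "wtrees (insert v V) (insert {u, v} E) f = wtrees V E (f(u := f u * (1 + f v))) + f v"
proof -
  define h where "h T = (insert v (fst T), insert {u, v} (snd T))" for T :: "'a set \<times> 'a set set"
  define S where "S = {T\<in>subtrees V E. u \<in> fst T}"
  have fin: "finite (subtrees V E)" using simple_graphD[OF G] finite_subtrees by blast
  have nov: "v \<notin> fst T" "{u, v} \<notin> snd T" if "T \<in> subtrees V E" for T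
    using that v simple_graphD(3)[OF G, of "{u, v}"] by (auto simp: subtrees_def)
  have fT: "finite (fst T)" if "T \<in> subtrees V E" for T
    using that finite_subset[OF _ simple_graphD(1)[OF G]] by (auto simp: subtrees_def)
  have inj: "inj_on h S"
    by (rule inj_on_inverseI[where g="\<lambda>T. (fst T - {v}, snd T - {{u, v}})"])
      (use nov in \<open>auto simp: h_def S_def prod_eq_iff\<close>)
  have vh: "({v}, {}) \<notin> h ` S" by (auto simp: h_def)
  have disj: "subtrees V E \<inter> insert ({v}, {}) (h ` S) = {}"
    using nov by (force simp: h_def)
  have "wtrees (insert v V) (insert {u, v} E) f
      = (\<Sum>T\<in>subtrees V E \<union> insert ({v}, {}) (h ` S). \<Prod>x\<in>fst T. f x)"
    unfolding wtrees_def subtrees_add_leaf[OF assms] S_def h_def ..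
  also have "\<dots> = wtrees V E f + (\<Sum>T\<in>insert ({v}, {}) (h ` S). \<Prod>x\<in>fst T. f x)"
    unfolding wtrees_def by (rule sum.union_disjoint) (use fin disj S_def in auto)
  also have "(\<Sum>T\<in>insert ({v}, {}) (h ` S). \<Prod>x\<in>fst T. f x) = f v + (\<Sum>T\<in>h ` S. \<Prod>x\<in>fst T. f x)"
    using vh fin by (simp add: S_def)
  also have "(\<Sum>T\<in>h ` S. \<Prod>x\<in>fst T. f x) = (\<Sum>T\<in>S. \<Prod>x\<in>fst (h T). f x)"
    by (simp add: sum.reindex[OF inj])
  also have "\<dots> = (\<Sum>T\<in>S. f v * f u * (\<Prod>x\<in>fst T - {u}. f x))"
  proof (rule sum.cong[OF refl])
    fix T assume T: "T \<in> S"
    then have "(\<Prod>x\<in>fst (h T). f x) = f v * (\<Prod>x\<in>fst T. f x)"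
      using fT nov by (simp add: h_def S_def)
    also have "(\<Prod>x\<in>fst T. f x) = f u * (\<Prod>x\<in>fst T - {u}. f x)"
      using T fT by (subst prod.remove[of _ u]) (auto simp: S_def)
    finally show "(\<Prod>x\<in>fst (h T). f x) = f v * f u * (\<Prod>x\<in>fst T - {u}. f x)" by simp
  qed
  also have "\<dots> = f v * f u * (\<Sum>T\<in>S. \<Prod>x\<in>fst T - {u}. f x)" by (simp add: sum_distrib_left)
  also have "wtrees V E f = wtrees V E (f(u := f u))" by simp
  finally show ?thesis unfolding wtrees_upd[OF G] S_def by (simp add: algebra_simps)
qed

subsection \<open>Subtrees of a cycle\<close>

text \<open>The vertices are listed periodically along all natural numbers, so that an arc that
  passes the starting vertex is still an interval of indices.\<close>

locale cycle_walk =
  fixes c :: "nat \<Rightarrow> 'a" and n :: nat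
  assumes n3: "n \<ge> 3" and c_eq_iff: "c i = c j \<longleftrightarrow> i mod n = j mod n"
begin

definition edge :: "nat \<Rightarrow> 'a set" where
  "edge i = {c i, c (Suc i)}"

definition verts :: "'a set" where
  "verts = c ` {..<n}"

definition edges :: "'a set set" where
  "edges = edge ` {..<n}"

lemma c_mod: "c (i mod n) = c i"
  by (simp add: c_eq_iff)

lemma edge_eq_iff: "edge i = edge j \<longleftrightarrow> i mod n = j mod n"
proof
  assume "i mod n = j mod n"
  moreover from this have "Suc i mod n = Suc j mod n" by (metis mod_Suc_eq)
  ultimately have "c i = c j" "c (Suc i) = c (Suc j)" by (simp_all add: c_eq_iff)
  then show "edge i = edge j" by (simp add: edge_def)
next
  assume "edge i = edge j"
  then consider "c i = c j" | "c i = c (Suc j)" "c (Suc i) = c j"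
    by (auto simp: edge_def doubleton_eq_iff)
  then show "i mod n = j mod n"
  proof cases
    \<comment> \<open>The same edge traversed in the opposite direction would force
      \<open>n dvd 2\<close>.\<close>
    case 2
    then have "i mod n = Suc j mod n" "Suc i mod n = j mod n" by (auto simp: c_eq_iff)
    then have "Suc (Suc j) mod n = j mod n" by (metis mod_Suc_eq)
    then have "n dvd Suc (Suc j) - j" by (metis mod_eq_dvd_iff_nat le_SucI le_refl)
    moreover have "Suc (Suc j) - j = 2" by simp
    ultimately have "n dvd 2" by simp
    then show ?thesis using n3 by (auto dest: dvd_imp_le)
  qed (simp add: c_eq_iff)
qed

lemma edge_mod: "edge (i mod n) = edge i"
  by (simp add: edge_eq_iff)

lemma c_in_verts [simp]: "c i \<in> verts"
  unfolding verts_def using n3 by (intro image_eqI[of _ _ "i mod n"]) (auto simp: c_mod)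

lemma edge_in_edges [simp]: "edge i \<in> edges"
  unfolding edges_def using n3 by (intro image_eqI[of _ _ "i mod n"]) (auto simp: edge_mod)

lemma mod_eq_in_window:
  assumes "(s::nat) \<le> i" "i < s + n" "s \<le> j" "j < s + n" "i mod n = j mod n"
  shows "i = j"
proof -
  have "i = j" if "s \<le> i" "i \<le> j" "j < s + n" "i mod n = j mod n" for i j
  proof -
    have "n dvd j - i" using that by (metis mod_eq_dvd_iff_nat)
    moreover have "j - i < n" using that by auto
    ultimately have "j - i = 0" by (meson dvd_imp_le neq0_conv not_le)
    then show ?thesis using that by simp
  qed
  from this[of i j] this[of j i] assms show ?thesis by (metis nat_le_linear)
qed

lemma inj_on_window: "k \<le> n \<Longrightarrow> inj_on c {s..<s + k}"
  by (rule inj_onI) (auto simp: c_eq_iff intro: mod_eq_in_window[of s])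

lemma window_cover:
  obtains j where "s \<le> j" "j < s + n" "j mod n = i mod n"
proof
  \<comment> \<open>This is \<open>s + ((i - s) mod n)\<close>, with \<open>n - s mod n\<close>
    added instead of \<open>s\<close> subtracted to stay within the natural numbers.\<close>
  define j where "j = s + (i + (n - s mod n)) mod n"
  show "s \<le> j" "j < s + n" using n3 by (auto simp: j_def)
  have "j mod n = (s mod n + (i + (n - s mod n))) mod n" by (simp add: j_def mod_simps)
  also have "s mod n + (i + (n - s mod n)) = i + n"
    using n3 mod_less_divisor[of n s] by linarith
  finally show "j mod n = i mod n" by simp
qed

lemma verts_window: "c ` {s..<s + n} = verts"
proof
  show "verts \<subseteq> c ` {s..<s + n}"
  proof
    fix x assume "x \<in> verts"
    then obtain i where "x = c i" by (auto simp: verts_def)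
    moreover obtain j where "s \<le> j" "j < s + n" "j mod n = i mod n" by (rule window_cover)
    ultimately show "x \<in> c ` {s..<s + n}" by (intro image_eqI[of _ _ j]) (auto simp: c_eq_iff)
  qed
qed auto

lemma edges_window: "edges = edge ` {s..<s + n}"
proof
  show "edges \<subseteq> edge ` {s..<s + n}"
  proof
    fix x assume "x \<in> edges"
    then obtain i where "x = edge i" by (auto simp: edges_def)
    moreover obtain j where "s \<le> j" "j < s + n" "j mod n = i mod n" by (rule window_cover)
    ultimately show "x \<in> edge ` {s..<s + n}" by (intro image_eqI[of _ _ j]) (auto simp: edge_eq_iff)
  qed
qed auto

lemma simple_graph_cycle: "simple_graph verts edges"
proof -
  have "c i \<noteq> c (Suc i)" for i
    using mod_eq_in_window[of i i "Suc i"] n3 by (auto simp: c_eq_iff)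
  moreover have "finite verts" by (simp add: verts_def)
  moreover have "\<exists>i. e = {c i, c (Suc i)}" if "e \<in> edges" for e
    using that by (auto simp: edges_def edge_def)
  ultimately show ?thesis unfolding simple_graph_def by (metis c_in_verts)
qed

lemma is_cycle_edges: "is_cycle edges"
  unfolding is_cycle_def
proof (intro exI[of _ "map c [0..<n]"] conjI)
  show "distinct (map c [0..<n])"
    using inj_on_window[of n 0] by (simp add: distinct_map atLeast0LessThan)
  have "map c [0..<n] ! ((i + 1) mod n) = c (Suc i)" for i
    using n3 c_mod[of "Suc i"] by simp
  then show "edges = {{map c [0..<n] ! i, map c [0..<n] ! ((i + 1) mod length (map c [0..<n]))}
      | i. i < length (map c [0..<n])}"
    unfolding edges_def edge_def by (auto simp: image_iff) (metis nth_map_upt add_0 diff_zero)+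
qed (use n3 in simp)

text \<open>For \<open>k = n\<close> the vertex set is the whole cycle, and \<open>i\<close> records
  which edge is omitted, namely the one entering \<open>c i\<close>.\<close>

definition arc :: "nat \<Rightarrow> nat \<Rightarrow> 'a set \<times> 'a set set" where
  "arc i k = (c ` {i..<i + k}, edge ` {i..<i + k - 1})"

lemma is_tree_arc:
  assumes "1 \<le> k" "k \<le> n"
  shows "is_tree (c ` {i..<i + k}) (edge ` {i..<i + k - 1})"
  using assms
proof (induction k rule: dec_induct)
  case base
  then show ?case by (simp add: is_tree_singleton)
next
  case (step k)
  then obtain m where m: "k = Suc m" by (cases k) auto
  have "c (i + k) \<notin> c ` {i..<i + k}"
  proof
    assume "c (i + k) \<in> c ` {i..<i + k}"
    then obtain j where "i \<le> j" "j < i + k" "j mod n = (i + k) mod n" by (auto simp: c_eq_iff)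
    then show False using mod_eq_in_window[of i j "i + k"] step by auto
  qed
  moreover have "e \<subseteq> c ` {i..<i + k}" if "e \<in> edge ` {i..<i + k - 1}" for e
    using that by (auto simp: edge_def)
  ultimately have "is_tree (insert (c (i + k)) (c ` {i..<i + k}))
      (insert {c (i + m), c (i + k)} (edge ` {i..<i + k - 1}))"
    using step m by (intro is_tree_add_leaf) auto
  moreover have "{i..<i + Suc k} = insert (i + k) {i..<i + k}"
    "{i..<i + Suc k - 1} = insert (i + m) {i..<i + k - 1}" using m by auto
  ultimately show ?case using m by (simp add: edge_def)
qed

lemma arc_in_subtrees:
  assumes "1 \<le> k" "k \<le> n"
  shows "arc i k \<in> subtrees verts edges"
proof -
  have "e \<subseteq> c ` {i..<i + k}" if "e \<in> edge ` {i..<i + k - 1}" for e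
    using that by (auto simp: edge_def)
  then show ?thesis using is_tree_arc[OF assms] by (auto simp: subtrees_def arc_def)
qed

text \<open>The number of vertices gives the length, but for full arcs only the edges give the
  start: every vertex of an arc other than its first has its incoming edge in the arc.\<close>

lemma arc_inj:
  assumes eq: "arc i k = arc j l" and "i < n" "j < n" "1 \<le> k" "k \<le> n" "1 \<le> l" "l \<le> n"
  shows "i = j \<and> k = l"
proof -
  have card: "card (c ` {s..<s + m}) = m" if "m \<le> n" for s m
    using card_image[OF inj_on_window[OF that]] by simp
  have kl: "k = l" using eq card[of k i] card[of l j] assms by (simp add: arc_def)
  have "c j \<in> c ` {i..<i + k}" using eq assms by (auto simp: arc_def)
  then obtain t where t: "i \<le> t" "t < i + k" "t mod n = j mod n" by (auto simp: c_eq_iff)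
  have "t = i"
  proof (rule ccontr)
    assume "t \<noteq> i"
    then obtain u where u: "t = Suc u" "i \<le> u" using t by (cases t) auto
    then have "edge u \<in> edge ` {i..<i + k - 1}" using t by auto
    then have "edge u \<in> edge ` {j..<j + l - 1}" using eq by (simp add: arc_def)
    then obtain s where s: "j \<le> s" "s < j + l - 1" "u mod n = s mod n" by (auto simp: edge_eq_iff)
    then have "Suc s mod n = t mod n" using u by (metis mod_Suc_eq)
    then have "Suc s mod n = j mod n" using t by simp
    moreover have "j \<le> Suc s" "Suc s < j + n" "j < j + n" using s assms by linarith+
    ultimately have "Suc s = j" using mod_eq_in_window[of j "Suc s" j] by simp
    then show False using s by simp
  qed
  then show ?thesis using t kl assms by simp
qed

text \<open>A subtree omits the edge following one of its vertices, as otherwise it would contain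
  the whole cycle. Walking backwards from that vertex as long as the edges are present gives an arc,
  and connectivity excludes anything else.\<close>

lemma subtrees_cycle:
  "subtrees verts edges = (\<lambda>(i, k). arc i k) ` ({..<n} \<times> {1..n})"
proof
  show "(\<lambda>(i, k). arc i k) ` ({..<n} \<times> {1..n}) \<subseteq> subtrees verts edges"
    using arc_in_subtrees by auto
  show "subtrees verts edges \<subseteq> (\<lambda>(i, k). arc i k) ` ({..<n} \<times> {1..n})"
  proof
    fix T assume "T \<in> subtrees verts edges"
    then obtain V' E' where T: "T = (V', E')" and V': "V' \<subseteq> verts" and E': "E' \<subseteq> edges"
      and inc: "\<And>e. e \<in> E' \<Longrightarrow> e \<subseteq> V'" and tree: "is_tree V' E'"
      by (auto simp: subtrees_def)
    have conn: "connected_graph V' E'" using tree by (simp add: is_tree_def)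
    have "\<exists>e. c e \<in> V' \<and> edge e \<notin> E'"
    proof (rule ccontr)
      assume "\<not> ?thesis"
      then have all: "edge i \<in> E'" if "c i \<in> V'" for i using that by blast
      obtain x where "x \<in> V'" using conn by (auto simp: connected_graph_def)
      then obtain i where i: "c i \<in> V'" using V' by (auto simp: verts_def)
      have "c (i + t) \<in> V'" for t
      proof (induction t)
        case (Suc t)
        then show ?case using inc[OF all[OF Suc]] by (simp add: edge_def)
      qed (use i in simp)
      then have "edge (i + t) \<in> E'" for t using all by blast
      then have "edge ` {i..<i + n} \<subseteq> E'" by (auto simp: le_iff_add)
      then have "edges \<in> cycles E'" using is_cycle_edges edges_window[of i] by (simp add: cycles_def)
      then show False using tree by (auto simp: is_tree_def)
    qed
    then obtain e where e: "c e \<in> V'" "edge e \<notin> E'" by blast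
    \<comment> \<open>The window starting at \<open>s\<close> ends with the missing edge, at offset
      \<open>n - 1\<close>, so that within the window the cycle is a linearly ordered path.\<close>
    define s where "s = Suc e"
    have last: "c (s + (n - 1)) = c e" "edge (s + (n - 1)) = edge e"
      using n3 by (simp_all add: c_eq_iff edge_eq_iff s_def)
    \<comment> \<open>The least such \<open>t\<close> is the offset of the first vertex of the
      arc.\<close>
    define Q where "Q t \<longleftrightarrow> (\<forall>r. t \<le> r \<and> r < n - 1 \<longrightarrow> edge (s + r) \<in> E')" for t
    define t where "t = (LEAST t. Q t)"
    have "Q (n - 1)" by (auto simp: Q_def)
    then have Qt: "Q t" and tn: "t \<le> n - 1" unfolding t_def by (auto intro: LeastI Least_le)
    have miss: "edge (s + (t - 1)) \<notin> E'" if "0 < t"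
    proof
      assume "edge (s + (t - 1)) \<in> E'"
      moreover have "t \<le> r" if "t - 1 \<le> r" "r \<noteq> t - 1" for r using that by simp
      ultimately have "Q (t - 1)" using Qt unfolding Q_def by metis
      then have "t \<le> t - 1" unfolding t_def by (rule Least_le)
      then show False using that by simp
    qed
    define A where "A = c ` {s + t..<s + n}"
    \<comment> \<open>No edge of the tree crosses between the part before offset \<open>t\<close>
      and the part from \<open>t\<close> on: the only candidates are those at offsets
      \<open>t - 1\<close> and \<open>n - 1\<close>, and both are missing.\<close>
    have eE: "\<exists>r<n - 1. f = edge (s + r) \<and> (Suc r < t \<or> t \<le> r)" if "f \<in> E'" for f
    proof -
      have "f \<in> edge ` {s..<s + n}" using that E' edges_window[of s] by blast
      then obtain j where j: "s \<le> j" "j < s + n" "f = edge j" by auto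
      define r where "r = j - s"
      have "f = edge (s + r)" "r < n" using j by (auto simp: r_def)
      moreover have "r \<noteq> n - 1" using that e last \<open>f = edge (s + r)\<close> by auto
      moreover have "r \<noteq> t - 1 \<or> t = 0" using that miss \<open>f = edge (s + r)\<close> by (metis neq0_conv)
      ultimately show ?thesis by (intro exI[of _ r]) auto
    qed
    have cA: "c (s + r) \<in> A \<longleftrightarrow> t \<le> r" if "r < n" for r
    proof
      assume "c (s + r) \<in> A"
      then obtain j where "s + t \<le> j" "j < s + n" "(s + r) mod n = j mod n" by (auto simp: A_def c_eq_iff)
      then show "t \<le> r" using mod_eq_in_window[of s "s + r" j] that by auto
    qed (use that in \<open>auto simp: A_def\<close>)
    have "V' \<subseteq> A"
    proof (rule connected_graph_closed_set[OF conn e(1)])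
      show "c e \<in> A" using cA[of "n - 1"] last tn n3 by simp
      fix f assume f: "f \<in> E'" "f \<inter> A \<noteq> {}"
      obtain r where r: "r < n - 1" "f = edge (s + r)" "Suc r < t \<or> t \<le> r" using eE[OF f(1)] by blast
      then show "f \<subseteq> A" using f cA[of r] cA[of "Suc r"] by (auto simp: edge_def)
    qed
    have E'eq: "E' = edge ` {s + t..<s + n - 1}"
    proof
      show "E' \<subseteq> edge ` {s + t..<s + n - 1}"
      proof
        fix f assume f: "f \<in> E'"
        obtain r where r: "r < n - 1" "f = edge (s + r)" "Suc r < t \<or> t \<le> r" using eE[OF f(1)] by blast
        have "c (s + r) \<in> A" using inc[OF f] r \<open>V' \<subseteq> A\<close> by (auto simp: edge_def)
        then have "t \<le> r" using cA[of r] r by auto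
        then show "f \<in> edge ` {s + t..<s + n - 1}" using r by auto
      qed
      show "edge ` {s + t..<s + n - 1} \<subseteq> E'"
      proof
        fix f assume "f \<in> edge ` {s + t..<s + n - 1}"
        then obtain j where j: "f = edge j" "s + t \<le> j" "j < s + n - 1" by auto
        then have "f = edge (s + (j - s))" "t \<le> j - s" "j - s < n - 1" by auto
        then show "f \<in> E'" using Qt unfolding Q_def by blast
      qed
    qed
    have "A \<subseteq> V'"
    proof
      fix x assume "x \<in> A"
      then obtain j where j: "x = c j" "s + t \<le> j" "j < s + n" by (auto simp: A_def)
      show "x \<in> V'"
      proof (cases "j = s + n - 1")
        case True
        then show ?thesis using j e last n3 by (simp add: s_def)
      next
        case False
        then have "edge j \<in> E'" using j E'eq by auto
        then show ?thesis using inc j by (auto simp: edge_def)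
      qed
    qed
    then have "V' = A" using \<open>V' \<subseteq> A\<close> by simp
    define i where "i = (s + t) mod n"
    have shift: "c (s + t + r) = c (i + r)" "edge (s + t + r) = edge (i + r)" for r
      by (simp_all add: c_eq_iff edge_eq_iff i_def mod_simps)
    have win: "{s + t..<s + n} = (+) (s + t) ` {0..<n - t}" "{i..<i + (n - t)} = (+) i ` {0..<n - t}"
      "{s + t..<s + n - 1} = (+) (s + t) ` {0..<n - t - 1}" "{i..<i + (n - t) - 1} = (+) i ` {0..<n - t - 1}"
      using tn n3 by (simp_all add: image_add_atLeastLessThan add.commute)
    have "T = arc i (n - t)"
      unfolding T \<open>V' = A\<close> A_def E'eq arc_def win image_image shift ..
    moreover have "i < n" "n - t \<in> {1..n}" using n3 tn by (auto simp: i_def)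
    ultimately show "T \<in> (\<lambda>(i, k). arc i k) ` ({..<n} \<times> {1..n})" by auto
  qed
qed

lemma wtrees_cycle:
  "wtrees verts edges f = (\<Sum>i<n. \<Sum>k=1..n. \<Prod>t=i..<i + k. f (c t))"
proof -
  have "wtrees verts edges f = (\<Sum>p\<in>{..<n} \<times> {1..n}. \<Prod>v\<in>fst (case p of (i, k) \<Rightarrow> arc i k). f v)"
    unfolding wtrees_def subtrees_cycle
    by (rule sum.reindex[unfolded o_def]) (auto intro!: inj_onI dest: arc_inj)
  also have "\<dots> = (\<Sum>i<n. \<Sum>k=1..n. \<Prod>v\<in>c ` {i..<i + k}. f v)"
    by (simp add: sum.cartesian_product arc_def case_prod_unfold)
  also have "\<dots> = (\<Sum>i<n. \<Sum>k=1..n. \<Prod>t=i..<i + k. f (c t))"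
    by (intro sum.cong refl) (simp add: prod.reindex[OF inj_on_window])
  finally show ?thesis .
qed

lemma prod_window: "(\<Prod>t=s..<s + n. f (c t)) = (\<Prod>v\<in>verts. f v)"
  unfolding verts_window[of s, symmetric] by (simp add: prod.reindex[OF inj_on_window])

end

lemma is_cycle_obtain_walk:
  assumes "is_cycle C"
  obtains c n where "cycle_walk c n" "C = cycle_walk.edges c n"
proof -
  obtain vs where vs: "length vs \<ge> 3" "distinct vs"
    and C: "C = {{vs ! i, vs ! ((i + 1) mod length vs)} | i. i < length vs}"
    using assms by (auto simp: is_cycle_def)
  define n where "n = length vs"
  define c where "c i = vs ! (i mod n)" for i
  have "n > 0" using vs by (auto simp: n_def)
  interpret cycle_walk c n
    by unfold_locales (use vs \<open>n > 0\<close> in \<open>auto simp: c_def n_def nth_eq_iff_index_eq\<close>)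
  have "C = edge ` {..<n}"
    unfolding C n_def[symmetric] by (auto simp: edge_def c_def)
  then have "C = edges" by (simp only: edges_def)
  then show ?thesis using that cycle_walk_axioms by blast
qed

subsection \<open>Short segments\<close>

lemma deg2_edges:
  assumes "simple_graph V E" "degree E d = 2" "e1 \<in> E" "e2 \<in> E" "e1 \<noteq> e2" "d \<in> e1" "d \<in> e2"
  shows "{e \<in> E. d \<in> e} = {e1, e2}"
proof (rule card_subset_eq[symmetric])
  show "finite {e \<in> E. d \<in> e}" using simple_graphD(2)[OF assms(1)] by simp
  show "card {e1, e2} = card {e \<in> E. d \<in> e}" using assms by (simp add: degree_def)
qed (use assms in auto)

lemma deg2_nbrs:
  assumes "simple_graph V E" "degree E d = 2" "{d, a} \<in> E" "{d, b} \<in> E" "{d, x} \<in> E" "a \<noteq> b"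
  shows "x = a \<or> x = b"
proof -
  have "{e \<in> E. d \<in> e} = {{d, a}, {d, b}}"
  proof (rule deg2_edges[OF assms(1-4)])
    show "{d, a} \<noteq> {d, b}" using assms(6) by (metis doubleton_eq_iff)
  qed simp_all
  moreover have "{d, x} \<in> {e \<in> E. d \<in> e}" using assms(5) by simp
  ultimately have "{d, x} \<in> {{d, a}, {d, b}}" by simp
  then show ?thesis by (auto simp: doubleton_eq_iff)
qed

lemma deg2_other:
  assumes "simple_graph V E" "degree E d = 2" "{d, a} \<in> E"
  obtains b where "{d, b} \<in> E" "b \<noteq> a" "b \<noteq> d" "b \<in> V"
proof -
  have "\<exists>e\<in>E. d \<in> e \<and> e \<noteq> {d, a}"
  proof (rule ccontr)
    assume "\<not> (\<exists>e\<in>E. d \<in> e \<and> e \<noteq> {d, a})"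
    moreover have "d \<in> {d, a}" by simp
    ultimately have "{e \<in> E. d \<in> e} = {{d, a}}" using assms(3) by blast
    then show False using assms(2) by (simp add: degree_def)
  qed
  then obtain e where e: "e \<in> E" "d \<in> e" "e \<noteq> {d, a}" by blast
  obtain x y where xy: "e = {x, y}" "x \<noteq> y" "x \<in> V" "y \<in> V"
    using assms(1) e(1) by (auto simp: simple_graph_def)
  show ?thesis
  proof (cases "x = d")
    case True
    then show ?thesis using that[of y] xy e by auto
  next
    case False
    then have "e = {d, x}" using xy e(2) by auto
    moreover from this have "x \<noteq> a" using e(3) by auto
    ultimately show ?thesis using that[of x] xy(3) e(1) False by simp
  qed
qed

lemma degree_pos:
  assumes "simple_graph V E" "e \<in> E" "v \<in> e"
  shows "degree E v \<noteq> 0"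
proof -
  have "finite {e \<in> E. v \<in> e}" "e \<in> {e \<in> E. v \<in> e}" using assms simple_graphD(2)[OF assms(1)] by simp_all
  then have "card {e \<in> E. v \<in> e} \<noteq> 0" by (metis card_0_eq empty_iff)
  then show ?thesis by (simp add: degree_def)
qed

lemma segment_subset:
  assumes "segment V E S"
  shows "S \<subseteq> E"
  using assms by (auto simp: segment_def)

lemma finite_segments:
  assumes "simple_graph V E"
  shows "finite {S. segment V E S}"
proof (rule finite_subset)
  show "{S. segment V E S} \<subseteq> Pow E" using segment_subset by blast
  show "finite (Pow E)" using simple_graphD(2)[OF assms] by simp
qed

lemma successively_rev_adj: "successively (adj E) p \<Longrightarrow> successively (adj E) (rev p)"
proof (unfold successively_rev)
  assume "successively (adj E) p"
  then show "successively (\<lambda>x y. adj E y x) p"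
    by (rule successively_mono) (rule adj_sym)
qed

text \<open>Otherwise a longest path of vertices of degree 2, extended by one vertex at both ends, is a
  segment of length at least 3; it cannot close up to a cycle, because the graph is connected and
  has a vertex whose degree is not 2.\<close>
lemma deg2_not_adjacent:
  assumes G: "simple_graph V E" and conn: "connected_graph V E"
    and le2: "\<And>S. segment V E S \<Longrightarrow> card S \<le> 2" and ex: "segment V E S0"
    and D: "D = {v\<in>V. degree E v = 2}" and e: "e \<in> E"
  shows "\<not> e \<subseteq> D"
proof
  assume eD: "e \<subseteq> D"
  have finD: "finite D" "D \<subseteq> V" using simple_graphD(1)[OF G] D by auto
  obtain p0 where "length p0 \<ge> 2" "set p0 \<subseteq> V" "degree E (hd p0) = 1 \<or> degree E (hd p0) \<ge> 3"
    using ex unfolding segment_def by blast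
  then have w0: "hd p0 \<in> V" "hd p0 \<notin> D" by (cases p0; auto simp: D)+
  define P where "P p \<longleftrightarrow> distinct p \<and> set p \<subseteq> D \<and> successively (adj E) p \<and> length p \<ge> 2" for p
  obtain a b where "e = {a, b}" "a \<noteq> b" using G e by (auto simp: simple_graph_def)
  then have "P [a, b]" using eD e by (simp add: P_def adj_def)
  moreover have "length p < Suc (card D)" if "P p" for p
    using that card_mono[of D "set p"] finD by (auto simp: P_def distinct_card less_Suc_eq_le)
  ultimately have "\<exists>p. P p \<and> (\<forall>q. P q \<longrightarrow> length q \<le> length p)"
    by (intro ex_has_greatest_nat[of _ _ _ "Suc (card D)"]) auto
  then obtain p1 where p1: "P p1" "\<And>q. P q \<Longrightarrow> length q \<le> length p1" by blast
  have nth_edge: "{p ! i, p ! Suc i} \<in> E" if "P p" "Suc i < length p" for p i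
    using successively_nth[of "adj E" p i] that by (simp add: P_def adj_def)
  have nth_D: "degree E (p ! i) = 2" if "P p" "i < length p" for p i
  proof -
    have "p ! i \<in> D" using that nth_mem[of i p] unfolding P_def by blast
    then show ?thesis using D by simp
  qed
  have "\<not> V \<subseteq> set p1" using w0 p1(1) by (auto simp: P_def)
  moreover obtain x where "x \<in> set p1" using p1(1) by (cases p1) (auto simp: P_def)
  ultimately obtain f where f: "f \<in> E" "f \<inter> set p1 \<noteq> {}" "\<not> f \<subseteq> set p1"
  proof -
    have "x \<in> V" using \<open>x \<in> set p1\<close> p1(1) finD(2) by (auto simp: P_def)
    then show ?thesis
      using connected_graph_closed_set[OF conn _ \<open>x \<in> set p1\<close>] that \<open>\<not> V \<subseteq> set p1\<close> by metis
  qed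
  obtain a' b' where ab': "f = {a', b'}" using G f(1) by (auto simp: simple_graph_def)
  obtain a b where ab: "{a, b} \<in> E" "a \<in> set p1" "b \<notin> set p1"
  proof (cases "a' \<in> set p1")
    case True
    then show ?thesis using that[of a' b'] ab' f by auto
  next
    case False
    then show ?thesis using that[of b' a'] ab' f by (auto simp: insert_commute)
  qed
  obtain j where j: "j < length p1" "a = p1 ! j" using ab(2) by (metis in_set_conv_nth)
  \<comment> \<open>An interior vertex of the path has both its edges on the path, so the edge to
    \<open>b\<close> starts at one of the two ends.\<close>
  have "j = 0 \<or> j = length p1 - 1"
  proof (rule ccontr)
    assume "\<not> (j = 0 \<or> j = length p1 - 1)"
    then obtain i where i: "j = Suc i" "Suc j < length p1" using j(1) by (cases j) auto
    have d: "degree E (p1 ! j) = 2" using nth_D[OF p1(1) j(1)] .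
    have E1: "{p1 ! j, p1 ! i} \<in> E" "{p1 ! j, p1 ! Suc j} \<in> E" "{p1 ! j, b} \<in> E"
      using nth_edge[OF p1(1), of i] nth_edge[OF p1(1), of j] i j ab(1) by (auto simp: insert_commute)
    have ne: "p1 ! i \<noteq> p1 ! Suc j" using i p1(1) by (simp add: P_def nth_eq_iff_index_eq)
    have "b = p1 ! i \<or> b = p1 ! Suc j" by (rule deg2_nbrs[OF G d E1 ne])
    then show False using ab(3) i by auto
  qed
  then obtain p where p: "P p" "length p = length p1" "set p = set p1" "a = p ! 0"
  proof
    assume "j = 0"
    then show ?thesis using that[of p1] p1(1) j by simp
  next
    assume "j = length p1 - 1"
    then have "a = rev p1 ! 0" using j rev_nth[of 0 p1] by fastforce
    then show ?thesis using that[of "rev p1"] p1(1) successively_rev_adj[of E p1]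
      by (simp add: P_def)
  qed
  have maxp: "length q \<le> length p" if "P q" for q using p1(2)[OF that] p(2) by simp
  define n where "n = length p"
  have n2: "n \<ge> 2" using p(1) by (simp add: P_def n_def)
  have bp: "b \<notin> set p" using ab(3) p(3) by simp
  have bV: "b \<in> V" using simple_graphD(3)[OF G ab(1)] by simp
  have pne: "p \<noteq> []" using n2 by (auto simp: n_def)
  then have hdp: "hd p = p ! 0" "last p = p ! (n - 1)"
    by (simp_all add: n_def hd_conv_nth last_conv_nth)
  have ba: "{b, a} \<in> E" using ab(1) by (simp add: insert_commute)
  have bD: "b \<notin> D"
  proof
    assume "b \<in> D"
    then have "P (b # p)" using p(1) bp ba p(4) hdp
      by (simp add: P_def successively_Cons adj_def)
    then show False using maxp[of "b # p"] by simp
  qed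
  have inj: "p ! i = p ! k \<longleftrightarrow> i = k" if "i < n" "k < n" for i k
    using that p(1) by (simp add: P_def n_def nth_eq_iff_index_eq)
  have "Suc (n - 2) = n - 1" using n2 by simp
  then have zE: "{p ! (n - 1), p ! (n - 2)} \<in> E"
    using nth_edge[OF p(1), of "n - 2"] n2 by (simp add: n_def insert_commute)
  have zdeg: "degree E (p ! (n - 1)) = 2" using nth_D[OF p(1), of "n - 1"] n2 by (simp add: n_def)
  obtain z where z: "{p ! (n - 1), z} \<in> E" "z \<noteq> p ! (n - 2)" "z \<noteq> p ! (n - 1)" "z \<in> V"
    using deg2_other[OF G zdeg zE] .
  \<comment> \<open>An earlier path vertex has two neighbours already, the next one and the previous
    one (\<open>b\<close> for the first vertex), so the last vertex of the path would be a
    third.\<close>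
  have zp: "z \<notin> set p"
  proof
    assume "z \<in> set p"
    then obtain i where i: "i < n" "z = p ! i" by (metis in_set_conv_nth n_def)
    have "i \<noteq> n - 1" "i \<noteq> n - 2" using z(2,3) i(2) by auto
    then have i3: "i + 2 < n" using i(1) by linarith
    have memp: "p ! k \<in> set p" if "k < n" for k using that by (simp add: n_def)
    have d: "degree E (p ! i) = 2" using nth_D[OF p(1)] i n_def by simp
    have E1: "{p ! i, p ! Suc i} \<in> E" "{p ! i, p ! (n - 1)} \<in> E"
      using nth_edge[OF p(1), of i] i i3 z n_def by (simp_all add: insert_commute)
    show False
    proof (cases i)
      case 0
      have "p ! Suc i \<noteq> b" using bp i3 memp[of "Suc i"] by auto
      moreover have "{p ! i, b} \<in> E" using ab(1) p(4) 0 by simp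
      ultimately have "p ! (n - 1) = p ! Suc i \<or> p ! (n - 1) = b"
        using deg2_nbrs[OF G d E1(1) _ E1(2)] by blast
      moreover have "p ! (n - 1) \<noteq> b" using bp i3 memp[of "n - 1"] by auto
      ultimately show False using inj[of "n - 1" "Suc i"] i3 by auto
    next
      case (Suc k)
      have "{p ! i, p ! k} \<in> E" using nth_edge[OF p(1), of k] Suc i n_def by (auto simp: insert_commute)
      moreover have "p ! Suc i \<noteq> p ! k" using inj[of "Suc i" k] i3 Suc by auto
      ultimately have "p ! (n - 1) = p ! Suc i \<or> p ! (n - 1) = p ! k"
        using deg2_nbrs[OF G d E1(1) _ E1(2)] by blast
      then show False using inj[of "n - 1" "Suc i"] inj[of "n - 1" k] i3 Suc by auto
    qed
  qed
  have zD: "z \<notin> D"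
  proof
    assume "z \<in> D"
    then have "P (p @ [z])" using p(1) zp z(1) hdp
      by (simp add: P_def successively_append_iff adj_def)
    then show False using maxp[of "p @ [z]"] by simp
  qed
  define q where "q = b # p @ [z]"
  have q: "length q = n + 2" "hd q = b" "last q = z" "butlast (tl q) = p"
    by (simp_all add: q_def n_def butlast_append)
  have q0: "q ! 0 = b" "q ! (n + 1) = z" and qS: "\<And>i. i < n \<Longrightarrow> q ! Suc i = p ! i"
    by (simp_all add: q_def n_def nth_append)
  have qE: "{q ! i, q ! Suc i} \<in> E" if "i \<le> n" for i
  proof (cases "i = 0 \<or> i = n")
    case True
    then show ?thesis
    proof
      assume "i = 0"
      then show ?thesis using q0 qS[of 0] n2 ab(1) p(4) by (simp add: insert_commute)
    next
      assume "i = n"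
      then show ?thesis using q0 qS[of "n - 1"] n2 z(1) by simp
    qed
  next
    case False
    then obtain k where "i = Suc k" by (cases i) auto
    then show ?thesis using False that qS[of k] qS[of "Suc k"] nth_edge[OF p(1), of k] n_def by simp
  qed
  \<comment> \<open>One of the two indices has to be interior: the ends \<open>b\<close> and
    \<open>z\<close> may coincide, as the ends of a segment may.\<close>
  have internal: "i = k" if h: "1 \<le> i" "i \<le> n" "k \<le> n + 1" "q ! i = q ! k" for i k
  proof -
    obtain i' where i': "i = Suc i'" using h(1) by (cases i) auto
    then have pi: "q ! i = p ! i'" "i' < n" using h qS by auto
    then have mem: "q ! i \<in> set p" by (simp add: n_def)
    have "k \<noteq> 0" "k \<noteq> n + 1" using h(4) mem q0 bp zp by metis+
    then obtain k' where k': "k = Suc k'" "k' < n" using h(3) by (cases k) auto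
    then show ?thesis using pi h(4) qS[of k'] inj[of i' k'] i' by simp
  qed
  define S where "S = {{q ! i, q ! (i + 1)} | i. i + 1 < length q}"
  have S: "S = (\<lambda>i. {q ! i, q ! Suc i}) ` {..n}" unfolding S_def q by auto
  have "inj_on (\<lambda>i. {q ! i, q ! Suc i}) {..n}"
  proof (rule linorder_inj_onI')
    fix i k assume ik: "i \<in> {..n}" "k \<in> {..n}" "i < k"
    show "{q ! i, q ! Suc i} \<noteq> {q ! k, q ! Suc k}"
    proof
      assume eq: "{q ! i, q ! Suc i} = {q ! k, q ! Suc k}"
      then have "q ! k = q ! i \<or> q ! k = q ! Suc i" by (metis insertI1 insertE singletonD)
      then have k: "k = Suc i" using internal[of k i] internal[of k "Suc i"] ik by auto
      then have "q ! i = q ! Suc (Suc i)" using eq by (metis doubleton_eq_iff)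
      then show False
        using internal[of i "Suc (Suc i)"] internal[of "Suc (Suc i)" i] ik k n2 by (cases i) auto
    qed
  qed
  then have cardS: "card S = n + 1" unfolding S by (simp add: card_image)
  have "degree E v = 1 \<or> degree E v \<ge> 3" if "{v, u} \<in> E" "v \<in> V" "v \<notin> D" for v u
    using degree_pos[OF G that(1), of v] that D by auto
  moreover have "{z, p ! (n - 1)} \<in> E" using z(1) by (simp add: insert_commute)
  ultimately have dg: "degree E b = 1 \<or> degree E b \<ge> 3" "degree E z = 1 \<or> degree E z \<ge> 3"
    using bV bD z(4) zD ba by metis+
  have "segment V E S"
    unfolding segment_def
  proof (rule exI[of _ q], intro conjI)
    show "set q \<subseteq> V" using bV z(4) p(1) finD(2) by (auto simp: q_def P_def)
    show "\<forall>i. i + 1 < length q \<longrightarrow> {q ! i, q ! (i + 1)} \<in> E" using qE q by simp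
    show "\<forall>v\<in>set (butlast (tl q)). degree E v = 2" unfolding q using p(1) D by (auto simp: P_def)
  qed (use q dg bp zp p(1) cardS S_def in \<open>simp_all add: P_def\<close>)
  then show False using le2[of S] cardS n2 by simp
qed

lemma segments_card1:
  assumes G: "simple_graph V E" and D: "D = {v\<in>V. degree E v = 2}"
  shows "{S. segment V E S \<and> card S = 1} = (\<lambda>e. {e}) ` {e\<in>E. e \<inter> D = {}}"
proof
  show "{S. segment V E S \<and> card S = 1} \<subseteq> (\<lambda>e. {e}) ` {e\<in>E. e \<inter> D = {}}"
  proof
    fix S assume "S \<in> {S. segment V E S \<and> card S = 1}"
    then obtain p where p: "length p \<ge> 2" "\<forall>i. i + 1 < length p \<longrightarrow> {p ! i, p ! (i+1)} \<in> E"
      "degree E (hd p) = 1 \<or> degree E (hd p) \<ge> 3" "degree E (last p) = 1 \<or> degree E (last p) \<ge> 3"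
      "S = {{p ! i, p ! (i+1)} | i. i + 1 < length p}" "card S = length p - 1" "card S = 1"
      by (auto simp: segment_def)
    then have "length p = 2" by linarith
    then obtain a b where ab: "p = [a, b]" by (auto simp: numeral_2_eq_2 length_Suc_conv)
    then have "S = {{a, b}}" "{a, b} \<in> E" using p(2,5) by (auto simp: less_Suc_eq)
    moreover have "a \<notin> D" "b \<notin> D" using p(3,4) ab D by auto
    ultimately show "S \<in> (\<lambda>e. {e}) ` {e\<in>E. e \<inter> D = {}}" by auto
  qed
  show "(\<lambda>e. {e}) ` {e\<in>E. e \<inter> D = {}} \<subseteq> {S. segment V E S \<and> card S = 1}"
  proof (rule image_subsetI)
    fix e assume "e \<in> {e\<in>E. e \<inter> D = {}}"
    then have e: "e \<in> E" "e \<inter> D = {}" by auto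
    obtain a b where ab: "e = {a, b}" "a \<in> V" "b \<in> V" using G e by (auto simp: simple_graph_def)
    have "degree E v = 1 \<or> degree E v \<ge> 3" if "v \<in> e" for v
      using degree_pos[OF G e(1) that] simple_graphD(3)[OF G e(1)] that e(2) D by force
    then have "segment V E {e}"
      unfolding segment_def using ab e(1)
      by (intro exI[of _ "[a, b]"]) (auto simp: less_Suc_eq)
    then show "{e} \<in> {S. segment V E S \<and> card S = 1}" by simp
  qed
qed

lemma path3_edges:
  "{{[a, b, c] ! i, [a, b, c] ! (i + 1)} | i. i + 1 < length [a, b, c]} = {{a, b}, {b, c}}"
proof -
  have "{i. i + 1 < length [a, b, c]} = {0, 1}" by auto
  then show ?thesis unfolding setcompr_eq_image by simp
qed

text \<open>Such a segment is the pair of edges at its middle vertex. Conversely, as no edge lies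
  inside \<open>D\<close>, the neighbours of a vertex of \<open>D\<close> have degree 1 or at least
  3 and can serve as ends.\<close>

lemma segments_card2:
  assumes G: "simple_graph V E" and D: "D = {v\<in>V. degree E v = 2}"
    and DD: "\<And>e. e \<in> E \<Longrightarrow> \<not> e \<subseteq> D"
  shows "{S. segment V E S \<and> card S = 2} = (\<lambda>d. {e\<in>E. d \<in> e}) ` D"
proof
  show "{S. segment V E S \<and> card S = 2} \<subseteq> (\<lambda>d. {e\<in>E. d \<in> e}) ` D"
  proof
    fix S assume "S \<in> {S. segment V E S \<and> card S = 2}"
    then obtain p where p: "length p \<ge> 2" "\<forall>i. i + 1 < length p \<longrightarrow> {p ! i, p ! (i+1)} \<in> E"
      "set p \<subseteq> V" "\<forall>v\<in>set (butlast (tl p)). degree E v = 2"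
      "S = {{p ! i, p ! (i+1)} | i. i + 1 < length p}" "card S = length p - 1" "card S = 2"
      by (auto simp: segment_def)
    then have "length p = 3" by linarith
    then obtain a b c where ab: "p = [a, b, c]" by (auto simp: numeral_3_eq_3 length_Suc_conv)
    have S: "S = {{a, b}, {b, c}}" unfolding p(5) ab by (rule path3_edges)
    have "{a, b} \<in> E" "{b, c} \<in> E" using p(2)[rule_format, of 0] p(2)[rule_format, of 1] ab by auto
    moreover have "{a, b} \<noteq> {b, c}" using S p(7) by auto
    moreover have "b \<in> V" "degree E b = 2" using p(3,4) ab by auto
    ultimately have "{e\<in>E. b \<in> e} = S" "b \<in> D" using deg2_edges[OF G] S D by auto
    then show "S \<in> (\<lambda>d. {e\<in>E. d \<in> e}) ` D" by auto
  qed
  show "(\<lambda>d. {e\<in>E. d \<in> e}) ` D \<subseteq> {S. segment V E S \<and> card S = 2}"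
  proof (rule image_subsetI)
    fix d assume d: "d \<in> D"
    then have deg: "degree E d = 2" "d \<in> V" by (auto simp: D)
    then have "card {e\<in>E. d \<in> e} \<noteq> 0" by (simp add: degree_def)
    then have "{e\<in>E. d \<in> e} \<noteq> {}" by (metis card.empty)
    then obtain e1 where e1: "e1 \<in> E" "d \<in> e1" by auto
    obtain a where a: "{d, a} \<in> E" "a \<noteq> d" "a \<in> V"
    proof -
      obtain x y where "e1 = {x, y}" "x \<noteq> y" "x \<in> V" "y \<in> V"
        using G e1(1) by (auto simp: simple_graph_def)
      then show ?thesis using that[of x] that[of y] e1 by (cases "d = x") (auto simp: insert_commute)
    qed
    obtain c where c: "{d, c} \<in> E" "c \<noteq> a" "c \<noteq> d" "c \<in> V" using deg2_other[OF G deg(1) a(1)] .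
    have S: "{e\<in>E. d \<in> e} = {{d, a}, {d, c}}"
      by (rule deg2_edges[OF G deg(1) a(1) c(1)]) (use c in \<open>auto simp: doubleton_eq_iff\<close>)
    have "a \<notin> D" "c \<notin> D" using DD[OF a(1)] DD[OF c(1)] d by auto
    then have dg: "degree E a = 1 \<or> degree E a \<ge> 3" "degree E c = 1 \<or> degree E c \<ge> 3"
      using degree_pos[OF G a(1), of a] degree_pos[OF G c(1), of c] a c D by auto
    have card: "card {{d, a}, {d, c}} = 2" using c by (auto simp: doubleton_eq_iff)
    have "segment V E {{d, a}, {d, c}}"
      unfolding segment_def
    proof (rule exI[of _ "[a, d, c]"], intro conjI)
      show "\<forall>i. i + 1 < length [a, d, c] \<longrightarrow> {[a, d, c] ! i, [a, d, c] ! (i + 1)} \<in> E"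
        using a c by (auto simp: less_Suc_eq insert_commute)
      show "{{d, a}, {d, c}} = {{[a, d, c] ! i, [a, d, c] ! (i + 1)} |i. i + 1 < length [a, d, c]}"
        unfolding path3_edges by (simp add: insert_commute)
    qed (use a c deg dg card in simp_all)
    then show "{e\<in>E. d \<in> e} \<in> {S. segment V E S \<and> card S = 2}" using S card by simp
  qed
qed

text \<open>An edge containing both \<open>x\<close> and \<open>y\<close> is \<open>{x, y}\<close>,
  so two vertices with the same incident edges would have degree at most 1.\<close>

lemma inj_on_deg2_edges:
  assumes G: "simple_graph V E" and D: "\<And>d. d \<in> D \<Longrightarrow> degree E d = 2"
  shows "inj_on (\<lambda>d. {e\<in>E. d \<in> e}) D"
proof (rule inj_onI, rule ccontr)
  fix x y assume xy: "x \<in> D" "y \<in> D" "{e\<in>E. x \<in> e} = {e\<in>E. y \<in> e}" "x \<noteq> y"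
  have "e = {x, y}" if e: "e \<in> E" "x \<in> e" for e
  proof -
    have "y \<in> e" using e xy(3) by blast
    moreover obtain a b where "e = {a, b}" using G e by (auto simp: simple_graph_def)
    ultimately show ?thesis using e xy(4) by auto
  qed
  then have "{e\<in>E. x \<in> e} \<subseteq> {{x, y}}" by auto
  from card_mono[OF _ this] show False using D[OF xy(1)] by (simp add: degree_def)
qed

lemma count_segment_sequence:
  assumes "simple_graph V E"
  shows "count (segment_sequence V E) k = card {S. segment V E S \<and> card S = k}"
proof -
  have "count (segment_sequence V E) k
    = (\<Sum>S\<in>segment_length -` {k} \<inter> {S. segment V E S}. count (mset_set {S. segment V E S}) S)"
    using finite_segments[OF assms] by (simp add: segment_sequence_def count_image_mset)
  also have "\<dots> = card (segment_length -` {k} \<inter> {S. segment V E S})"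
    using finite_segments[OF assms] by (simp add: count_mset_set)
  also have "segment_length -` {k} \<inter> {S. segment V E S} = {S. segment V E S \<and> card S = k}"
    by (auto simp: segment_length_def)
  finally show ?thesis .
qed

text \<open>Replaces the segment sequence by local data: the vertices of degree 2 count the segments
  of length 2, the edges avoiding them those of length 1.\<close>

lemma short_segments_counts:
  assumes G: "simple_graph V E" and conn: "connected_graph V E" and D: "D = {v\<in>V. degree E v = 2}"
    and seq: "segment_sequence V E = mset l" and l: "l \<noteq> []" "\<And>x. x \<in> set l \<Longrightarrow> x \<le> 2"
  shows "\<forall>e\<in>E. \<not> e \<subseteq> D" "set l \<subseteq> {1, 2}"
    "count (mset l) 2 = card D" "count (mset l) 1 = card {e\<in>E. e \<inter> D = {}}"
proof -
  have set: "set l = card ` {S. segment V E S}"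
    using arg_cong[OF seq, of set_mset] finite_segments[OF G]
    by (simp add: segment_sequence_def segment_length_def[abs_def])
  then have le2: "\<And>S. segment V E S \<Longrightarrow> card S \<le> 2" using l(2) by auto
  obtain S0 where S0: "segment V E S0" using set l(1) by fastforce
  show DD: "\<forall>e\<in>E. \<not> e \<subseteq> D" by (intro ballI deg2_not_adjacent[OF G conn le2 S0 D])
  have ge1: "card S \<ge> 1" if "segment V E S" for S using that by (auto simp: segment_def)
  have "card S = 1 \<or> card S = 2" if "segment V E S" for S using le2[OF that] ge1[OF that] by linarith
  then show "set l \<subseteq> {1, 2}" using set by auto
  show "count (mset l) 2 = card D"
    using count_segment_sequence[OF G, of 2] segments_card2[OF G D] DD D
      card_image[OF inj_on_deg2_edges[OF G, of D]] seq by simp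
  show "count (mset l) 1 = card {e\<in>E. e \<inter> D = {}}"
    using count_segment_sequence[OF G, of 1] segments_card1[OF G D] seq
    by (simp add: card_image)
qed

subsection \<open>Peeling a unicyclic graph\<close>

text \<open>Graphs obtained from a base graph by attaching pendent edges (counted by \<open>q\<close>) and pendent
  paths of length 2 whose middle vertex lies in \<open>D\<close> (counted by \<open>p\<close>). In the application \<open>D\<close> is
  the set of vertices that have degree 2 in the final graph.\<close>
inductive grown :: "'a set \<Rightarrow> 'a set \<Rightarrow> 'a set set \<Rightarrow> nat \<Rightarrow> nat \<Rightarrow> 'a set \<Rightarrow> 'a set set \<Rightarrow> bool"
  for D W C where
  base: "grown D W C 0 0 W C"
| leaf: "grown D W C p q V E \<Longrightarrow> u \<in> V \<Longrightarrow> u \<notin> D \<Longrightarrow> v \<notin> V \<Longrightarrow> v \<notin> D \<Longrightarrow>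
    grown D W C p (Suc q) (insert v V) (insert {u, v} E)"
| path: "grown D W C p q V E \<Longrightarrow> w \<in> V \<Longrightarrow> w \<notin> D \<Longrightarrow> u \<notin> V \<Longrightarrow> u \<in> D \<Longrightarrow> v \<notin> insert u V \<Longrightarrow> v \<notin> D \<Longrightarrow>
    grown D W C (Suc p) q (insert v (insert u V)) (insert {u, v} (insert {w, u} E))"

lemma grown_graph:
  assumes "grown D W C p q V E" "simple_graph W C"
  shows "simple_graph V E \<and> W \<subseteq> V \<and> C \<subseteq> E"
  using assms
proof (induction rule: grown.induct)
  case (leaf p q V E u v)
  then show ?case using simple_graph_add_leaf[of V E u v] by auto
next
  case (path p q V E w u v)
  then have "simple_graph (insert u V) (insert {w, u} E)" using simple_graph_add_leaf[of V E w u] by simp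
  then have "simple_graph (insert v (insert u V)) (insert {u, v} (insert {w, u} E))"
    using path simple_graph_add_leaf[of "insert u V" "insert {w, u} E" u v] by simp
  then show ?case using path by auto
qed auto

lemma grown_connected:
  assumes "grown D W C p q V E" "connected_graph W C"
  shows "connected_graph V E"
  using assms
proof (induction rule: grown.induct)
  case (leaf p q V E u v)
  then show ?case using connected_graph_add_leaf[of V E u v] by simp
next
  case (path p q V E w u v)
  then have "connected_graph (insert u V) (insert {w, u} E)"
    using connected_graph_add_leaf[of V E w u] by simp
  then show ?case using connected_graph_add_leaf[of "insert u V" "insert {w, u} E" u v] by simp
qed

text \<open>A pendent edge joins two vertices outside \<open>D\<close> and a pendent path adds one
  vertex to \<open>D\<close>. So \<open>p\<close> and \<open>q\<close> are the numbers of segments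
  of length 2 and 1 that are not on the base graph.\<close>

lemma grown_counts:
  assumes "grown D W C p q V E" "simple_graph W C"
  shows "card (V \<inter> D) = card (W \<inter> D) + p \<and>
    card {e\<in>E. e \<inter> D = {}} = card {e\<in>C. e \<inter> D = {}} + q"
  using assms
proof (induction rule: grown.induct)
  case (leaf p q V E u v)
  have G: "simple_graph V E" using grown_graph[OF leaf.hyps(1) leaf.prems] by blast
  have "{u, v} \<notin> E" using simple_graphD(3)[OF G, of "{u, v}"] leaf by auto
  moreover have "{e \<in> insert {u, v} E. e \<inter> D = {}} = insert {u, v} {e\<in>E. e \<inter> D = {}}"
    using leaf by auto
  ultimately show ?case using leaf simple_graphD(2)[OF G] by simp
next
  case (path p q V E w u v)
  have G: "simple_graph V E" using grown_graph[OF path.hyps(1) path.prems] by blast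
  have "{e \<in> insert {u, v} (insert {w, u} E). e \<inter> D = {}} = {e\<in>E. e \<inter> D = {}}"
    using path by auto
  moreover have "insert v (insert u V) \<inter> D = insert u (V \<inter> D)" using path by auto
  ultimately show ?case using path simple_graphD(1)[OF G] by simp
qed simp

text \<open>Raising the new weight of \<open>u\<close> from \<open>f u * (1 + f v)\<close> to
  \<open>2 * f u * f v\<close> adds \<open>f u * (f v - 1)\<close> to it. With slope at least 1 this
  pays for all but 1 of the summand \<open>f v\<close>. Equality holds for
  \<open>f v = 1\<close>.\<close>

lemma wtrees_add_leaf_le:
  assumes G: "simple_graph V E" and "u \<in> V" "v \<notin> V" "1 \<le> f u" "1 \<le> f v"
  shows "wtrees (insert v V) (insert {u, v} E) f \<le> wtrees V E (f(u := 2 * f u * f v)) + 1"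
proof -
  obtain a b where ab: "f u = Suc a" "f v = Suc b" using assms by (metis Suc_le_D One_nat_def)
  have "f u * (1 + f v) \<le> 2 * f u * f v" "f v - 1 \<le> 2 * f u * f v - f u * (1 + f v)"
    by (simp_all add: ab algebra_simps)
  then show ?thesis
    using wtrees_upd_mono[OF G assms(2), of "f u * (1 + f v)" "2 * f u * f v" f]
      wtrees_add_leaf[OF G assms(2,3), of f] assms(5) by linarith
qed

lemma wtrees_add_path:
  assumes G: "simple_graph V E" and "w \<in> V" "u \<notin> V" "v \<notin> insert u V" "f u = 1"
  shows "wtrees (insert v (insert u V)) (insert {u, v} (insert {w, u} E)) f
    = wtrees V E (f(w := f w * (2 + f v))) + (1 + 2 * f v)"
proof -
  have wu: "w \<noteq> u" using assms by auto
  have G': "simple_graph (insert u V) (insert {w, u} E)" by (rule simple_graph_add_leaf[OF G assms(2,3)])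
  have "wtrees (insert v (insert u V)) (insert {u, v} (insert {w, u} E)) f
    = wtrees (insert u V) (insert {w, u} E) (f(u := 1 + f v)) + f v"
    using wtrees_add_leaf[OF G', of u v f] assms by simp
  also have "wtrees (insert u V) (insert {w, u} E) (f(u := 1 + f v))
    = wtrees V E ((f(u := 1 + f v))(w := f w * (2 + f v))) + (1 + f v)"
    using wtrees_add_leaf[OF G, of w u "f(u := 1 + f v)"] assms wu by simp
  also have "wtrees V E ((f(u := 1 + f v))(w := f w * (2 + f v))) = wtrees V E (f(w := f w * (2 + f v)))"
    by (rule wtrees_cong) (use assms in auto)
  finally show ?thesis by simp
qed

lemma wtrees_add_path_le:
  assumes G: "simple_graph V E" and "w \<in> V" "u \<notin> V" "v \<notin> insert u V" "f u = 1" "1 \<le> f w" "1 \<le> f v"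
  shows "wtrees (insert v (insert u V)) (insert {u, v} (insert {w, u} E)) f
    \<le> wtrees V E (f(w := 3 * f w * f v)) + 3"
proof -
  obtain a b where ab: "f w = Suc a" "f v = Suc b" using assms by (metis Suc_le_D One_nat_def)
  \<comment> \<open>The increase of the weight is \<open>2 * f w * (f v - 1)\<close>, which covers
    all but 3 of the summand \<open>1 + 2 * f v\<close>.\<close>
  have "f w * (2 + f v) \<le> 3 * f w * f v" "2 * f v - 2 \<le> 3 * f w * f v - f w * (2 + f v)"
    by (simp_all add: ab algebra_simps)
  then show ?thesis
    using wtrees_upd_mono[OF G assms(2), of "f w * (2 + f v)" "3 * f w * f v" f]
      wtrees_add_path[of V E w u v f, OF assms(1-5)] assms(7) by linarith
qed

lemma prod_upd:
  fixes f :: "'a \<Rightarrow> nat"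
  assumes "finite V" "u \<in> V"
  shows "(\<Prod>x\<in>V. (f(u := k * f u)) x) = k * (\<Prod>x\<in>V. f x)"
proof -
  have "(\<Prod>x\<in>V - {u}. (f(u := k * f u)) x) = (\<Prod>x\<in>V - {u}. f x)" by (rule prod.cong) auto
  then show ?thesis using assms by (simp add: prod.remove[of V u])
qed

text \<open>The induction removes the outermost attachment and passes its weight inwards, hence the
  arbitrary \<open>f\<close>. The factors 2 and 3 in the peeling steps make the product of the final
  weights depend on \<open>p\<close> and \<open>q\<close> only. The last clause says that an
  attachment at a base vertex at least doubles its weight, and triples it if all attachments are
  paths; it is stated relative to \<open>f\<close> so that it survives the increase from
  \<open>f\<close> to \<open>f1\<close>.\<close>

lemma grown_wtrees_le:
  assumes "grown D W C p q V E" "simple_graph W C" "\<And>x. 1 \<le> f x" "\<And>x. x \<in> D \<Longrightarrow> f x = 1"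
  shows "\<exists>g. (\<forall>x. f x \<le> g x) \<and> (\<forall>x\<in>D. g x = 1) \<and> wtrees V E f \<le> wtrees W C g + (3 * p + q) \<and>
    (\<Prod>x\<in>W. g x) = 3 ^ p * 2 ^ q * (\<Prod>x\<in>V. f x) \<and>
    (\<forall>x\<in>W - D. (\<exists>e\<in>E - C. x \<in> e) \<longrightarrow> 2 * f x \<le> g x \<and> (q = 0 \<longrightarrow> 3 * f x \<le> g x))"
  using assms
proof (induction arbitrary: f rule: grown.induct)
  case base
  then show ?case by auto
next
  case (leaf p q V E u v)
  have G: "simple_graph V E" "W \<subseteq> V" using grown_graph[OF leaf.hyps(1) leaf.prems(1)] by auto
  have fin: "finite V" using simple_graphD(1)[OF G(1)] .
  define f1 where "f1 = f(u := 2 * f v * f u)"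
  have f1: "f x \<le> f1 x" "1 \<le> f1 x" for x
    using leaf.prems(2)[of x] leaf.prems(2)[of v] by (auto simp: f1_def)
  have f1D: "f1 x = 1" if "x \<in> D" for x using leaf that by (auto simp: f1_def)
  obtain g where g: "\<forall>x. f1 x \<le> g x" "\<forall>x\<in>D. g x = 1" "wtrees V E f1 \<le> wtrees W C g + (3 * p + q)"
    "(\<Prod>x\<in>W. g x) = 3 ^ p * 2 ^ q * (\<Prod>x\<in>V. f1 x)"
    "\<forall>x\<in>W - D. (\<exists>e\<in>E - C. x \<in> e) \<longrightarrow> 2 * f1 x \<le> g x \<and> (q = 0 \<longrightarrow> 3 * f1 x \<le> g x)"
    using leaf.IH[of f1, OF leaf.prems(1) f1(2) f1D] by blast
  have "wtrees (insert v V) (insert {u, v} E) f \<le> wtrees V E f1 + 1"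
    using wtrees_add_leaf_le[OF G(1) leaf.hyps(2,4), of f] leaf.prems(2) by (simp add: f1_def mult_ac)
  moreover have "(\<Prod>x\<in>V. f1 x) = 2 * (\<Prod>x\<in>insert v V. f x)"
    unfolding f1_def using prod_upd[OF fin leaf.hyps(2)] leaf.hyps(4) fin by simp
  moreover have "2 * f x \<le> g x" if "x \<in> W - D" "\<exists>e\<in>insert {u, v} E - C. x \<in> e" for x
  proof (cases "x = u")
    case True
    then have "2 * f x \<le> f1 x" using leaf.prems(2)[of v] by (simp add: f1_def)
    then show ?thesis using g(1) le_trans by blast
  next
    case False
    then have "\<exists>e\<in>E - C. x \<in> e" using that leaf.hyps(4) G(2) by auto
    then have "2 * f1 x \<le> g x" using g(5) that by blast
    then show ?thesis using f1(1)[of x] by linarith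
  qed
  moreover have "f x \<le> g x" for x using le_trans[OF f1(1)[of x]] g(1) by simp
  ultimately show ?case using g by (intro exI[of _ g]) simp
next
  case (path p q V E w u v)
  have G: "simple_graph V E" "W \<subseteq> V" using grown_graph[OF path.hyps(1) path.prems(1)] by auto
  have fin: "finite V" using simple_graphD(1)[OF G(1)] .
  define f1 where "f1 = f(w := 3 * f v * f w)"
  have f1: "f x \<le> f1 x" "1 \<le> f1 x" for x
    using path.prems(2)[of x] path.prems(2)[of v] by (auto simp: f1_def)
  have f1D: "f1 x = 1" if "x \<in> D" for x using path that by (auto simp: f1_def)
  obtain g where g: "\<forall>x. f1 x \<le> g x" "\<forall>x\<in>D. g x = 1" "wtrees V E f1 \<le> wtrees W C g + (3 * p + q)"
    "(\<Prod>x\<in>W. g x) = 3 ^ p * 2 ^ q * (\<Prod>x\<in>V. f1 x)"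
    "\<forall>x\<in>W - D. (\<exists>e\<in>E - C. x \<in> e) \<longrightarrow> 2 * f1 x \<le> g x \<and> (q = 0 \<longrightarrow> 3 * f1 x \<le> g x)"
    using path.IH[of f1, OF path.prems(1) f1(2) f1D] by blast
  have fu: "f u = 1" using path by simp
  have "wtrees (insert v (insert u V)) (insert {u, v} (insert {w, u} E)) f \<le> wtrees V E f1 + 3"
    using wtrees_add_path_le[of V E w u v f, OF G(1) path.hyps(2,4,6) fu] path.prems(2)
    by (simp add: f1_def mult_ac)
  moreover have "(\<Prod>x\<in>V. f1 x) = 3 * (\<Prod>x\<in>insert v (insert u V). f x)"
    unfolding f1_def using prod_upd[OF fin path.hyps(2)] path.hyps(4,6) fin fu by simp
  moreover have "2 * f x \<le> g x \<and> (q = 0 \<longrightarrow> 3 * f x \<le> g x)"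
    if "x \<in> W - D" "\<exists>e\<in>insert {u, v} (insert {w, u} E) - C. x \<in> e" for x
  proof (cases "x = w")
    case True
    then have "3 * f x \<le> f1 x" using path.prems(2)[of v] by (simp add: f1_def)
    then have "3 * f x \<le> g x" using g(1) le_trans by blast
    then show ?thesis by linarith
  next
    case False
    then have "\<exists>e\<in>E - C. x \<in> e" using that path.hyps(4,6) G(2) by auto
    then have "2 * f1 x \<le> g x \<and> (q = 0 \<longrightarrow> 3 * f1 x \<le> g x)" using g(5) that by blast
    then show ?thesis using f1(1)[of x] by (auto intro: le_trans)
  qed
  moreover have "f x \<le> g x" for x using le_trans[OF f1(1)[of x]] g(1) by simp
  ultimately show ?case using g by (intro exI[of _ g]) simp
qed

section \<open>Growing a unicyclic graph from its cycle\<close>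

lemma rtranclp_distinct_path:
  assumes "R\<^sup>*\<^sup>* x y"
  obtains p where "p \<noteq> []" "hd p = x" "last p = y" "distinct p" "successively R p"
proof -
  have "\<exists>p. p \<noteq> [] \<and> hd p = x \<and> last p = y \<and> distinct p \<and> successively R p"
    using assms
  proof (induction rule: converse_rtranclp_induct)
    case base
    show ?case by (rule exI[of _ "[y]"]) simp
  next
    case (step x z)
    then obtain p where p: "p \<noteq> []" "hd p = z" "last p = y" "distinct p" "successively R p" by blast
    show ?case
    proof (cases "x \<in> set p")
      case True
      then obtain as bs where "p = as @ x # bs" by (meson split_list)
      then show ?thesis using p by (intro exI[of _ "x # bs"]) (auto simp: successively_append_iff)
    next
      case False
      then show ?thesis using p step(1) by (intro exI[of _ "x # p"]) (auto simp: successively_Cons)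
    qed
  qed
  then show ?thesis using that by blast
qed

lemma cycle_through_new_edge:
  assumes conn: "connected_graph V E" and "u \<in> V" "v \<in> V" "u \<noteq> v" and new: "{u, v} \<notin> E"
  obtains C where "is_cycle C" "{u, v} \<in> C" "C \<subseteq> insert {u, v} E"
proof -
  have "(adj E)\<^sup>*\<^sup>* u v" using conn assms by (auto simp: connected_graph_def)
  then obtain p where p: "p \<noteq> []" "hd p = u" "last p = v" "distinct p" "successively (adj E) p"
    by (rule rtranclp_distinct_path)
  define n where "n = length p"
  have n0: "n > 0" using p by (simp add: n_def)
  have ends: "p ! 0 = u" "p ! (n - 1) = v" using p by (simp_all add: hd_conv_nth last_conv_nth n_def)
  have step: "{p ! i, p ! Suc i} \<in> E" if "Suc i < n" for i
    using successively_nth[OF p(5), of i] that by (simp add: n_def adj_def)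
  have "n \<noteq> 1" using ends \<open>u \<noteq> v\<close> by auto
  moreover have "n \<noteq> 2" using step[of 0] ends new by (auto simp: numeral_2_eq_2)
  ultimately have n3: "n \<ge> 3" using n0 by linarith
  define C where "C = {{p ! i, p ! ((i + 1) mod n)} | i. i < n}"
  have "is_cycle C" unfolding is_cycle_def C_def using p n3 n_def by blast
  moreover have "{u, v} \<in> C"
    unfolding C_def using ends n3 by (intro CollectI exI[of _ "n - 1"]) (auto simp: insert_commute)
  moreover have "C \<subseteq> insert {u, v} E"
  proof
    fix e assume "e \<in> C"
    then obtain i where i: "i < n" "e = {p ! i, p ! ((i + 1) mod n)}" by (auto simp: C_def)
    show "e \<in> insert {u, v} E"
    proof (cases "Suc i < n")
      case True
      then show ?thesis using i step by simp
    next
      case False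
      then have "Suc i = n" using i by simp
      then have "i = n - 1" "(i + 1) mod n = 0" by auto
      then show ?thesis using i ends by (auto simp: insert_commute)
    qed
  qed
  ultimately show ?thesis using that by blast
qed

text \<open>A maximal subgraph grown from the cycle is everything: any further edge between two of its
  vertices would close a second cycle.\<close>
lemma unicyclic_grown:
  assumes G: "simple_graph V E" and conn: "connected_graph V E" and cyc: "cycles E = {C}"
    and D2: "\<And>d. d \<in> D \<Longrightarrow> degree E d = 2" and DD: "\<And>e. e \<in> E \<Longrightarrow> \<not> e \<subseteq> D"
    and W: "simple_graph W C" "connected_graph W C" "W \<subseteq> V" and WC: "W \<subseteq> \<Union>C"
  shows "\<exists>p q. grown D W C p q V E"
proof -
  have C: "C \<subseteq> E" "is_cycle C" using cyc by (auto simp: cycles_def)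
  have finV: "finite V" using simple_graphD(1)[OF G] .
  \<comment> \<open>The last condition says that vertices of \<open>D\<close> already reached have
    all their edges. It guarantees that the graph can only be extended at a vertex outside
    \<open>D\<close>, as \<open>leaf\<close> and \<open>path\<close> demand.\<close>
  define good where "good V0 \<longleftrightarrow> V0 \<subseteq> V \<and> (\<exists>p q E0. grown D W C p q V0 E0 \<and> E0 \<subseteq> E \<and>
      (\<forall>e\<in>E. e \<inter> D \<inter> V0 \<noteq> {} \<longrightarrow> e \<in> E0))" for V0
  have goodI: "good V1" if "grown D W C p q V1 E1" "V1 \<subseteq> V" "E1 \<subseteq> E"
    "\<forall>e\<in>E. e \<inter> D \<inter> V1 \<noteq> {} \<longrightarrow> e \<in> E1" for p q V1 E1
    unfolding good_def using that by blast
  have "good W"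
  proof -
    \<comment> \<open>A vertex of \<open>D\<close> on the cycle has two edges there, which exhausts
      its degree.\<close>
    have "e \<in> C" if e: "e \<in> E" "d \<in> e" "d \<in> D" "d \<in> W" for d e
    proof -
      obtain e1 where e1: "e1 \<in> C" "d \<in> e1" using e WC by auto
      obtain e2 where e2: "e2 \<in> C" "d \<in> e2" "e2 \<noteq> e1" using is_cycle_two_edges[OF C(2) e1] .
      have "{e \<in> E. d \<in> e} = {e1, e2}" by (rule deg2_edges[OF G D2]) (use e e1 e2 C in auto)
      then have "e \<in> {e1, e2}" using e by auto
      then show ?thesis using e1 e2 by auto
    qed
    then have "\<forall>e\<in>E. e \<inter> D \<inter> W \<noteq> {} \<longrightarrow> e \<in> C" by auto
    then show ?thesis using goodI[OF grown.base] W(3) C(1) by blast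
  qed
  then have "\<exists>V0. good V0 \<and> (\<forall>V1. good V1 \<longrightarrow> card V1 \<le> card V0)"
    by (intro ex_has_greatest_nat[of _ _ _ "Suc (card V)"]) (auto simp: good_def finV card_mono less_Suc_eq_le)
  then obtain V0 where V0: "good V0" "\<And>V1. good V1 \<Longrightarrow> card V1 \<le> card V0" by blast
  then obtain p q E0 where gr: "grown D W C p q V0 E0" and E0: "E0 \<subseteq> E" and sub: "V0 \<subseteq> V"
    and closed: "\<And>e. e \<in> E \<Longrightarrow> e \<inter> D \<inter> V0 \<noteq> {} \<Longrightarrow> e \<in> E0"
    by (auto simp: good_def)
  have G0: "simple_graph V0 E0" "W \<subseteq> V0" "C \<subseteq> E0" using grown_graph[OF gr W(1)] by auto
  have conn0: "connected_graph V0 E0" using grown_connected[OF gr W(2)] .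
  have finV0: "finite V0" using simple_graphD(1)[OF G0(1)] .
  have inV0: "e \<subseteq> V0" if "e \<in> E0" for e using simple_graphD(3)[OF G0(1) that] .
  have no_new: False if h: "connected_graph V1 E1" "C \<subseteq> E1" "E1 \<subseteq> E" "{a, b} \<in> E" "{a, b} \<notin> E1"
    "a \<in> V1" "b \<in> V1" "a \<noteq> b" for V1 E1 a b
  proof -
    obtain C' where C': "is_cycle C'" "{a, b} \<in> C'" "C' \<subseteq> insert {a, b} E1"
      using cycle_through_new_edge[OF h(1,6,7,8,5)] .
    then have "C' \<in> cycles E" using h(2,3,4) by (auto simp: cycles_def)
    then show False using cyc C' h(2,5) by auto
  qed
  have "V \<subseteq> V0"
  proof (rule ccontr)
    assume "\<not> V \<subseteq> V0"
    moreover obtain x where "x \<in> V0" using conn0 by (auto simp: connected_graph_def)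
    ultimately obtain e where e: "e \<in> E" "e \<inter> V0 \<noteq> {}" "\<not> e \<subseteq> V0"
      using connected_graph_closed_set[OF conn, of x V0] sub by blast
    obtain a b where ab: "e = {a, b}" "a \<noteq> b" using G e(1) by (auto simp: simple_graph_def)
    obtain w u where wu: "e = {w, u}" "w \<noteq> u" "w \<in> V0" "u \<notin> V0"
    proof (cases "a \<in> V0")
      case True
      then show ?thesis using that[of a b] ab e by auto
    next
      case False
      then show ?thesis using that[of b a] ab e by auto
    qed
    have wD: "w \<notin> D"
    proof
      assume "w \<in> D"
      then have "e \<in> E0" using closed[OF e(1)] wu by auto
      then show False using inV0 wu by auto
    qed
    have uV: "u \<in> V" using simple_graphD(3)[OF G e(1)] wu by auto
    show False
    proof (cases "u \<in> D")
      case False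
      have "grown D W C p (Suc q) (insert u V0) (insert {w, u} E0)"
        using grown.leaf[OF gr wu(3) wD wu(4) False] .
      moreover have "\<forall>e'\<in>E. e' \<inter> D \<inter> insert u V0 \<noteq> {} \<longrightarrow> e' \<in> insert {w, u} E0"
        using closed False by auto
      ultimately have "good (insert u V0)"
        using E0 e(1) wu(1) uV sub by (intro goodI[of p "Suc q" _ "insert {w, u} E0"]) simp_all
      then show False using V0(2)[of "insert u V0"] finV0 wu(4) by simp
    next
      case True
      \<comment> \<open>The second edge of a new vertex \<open>u\<close> of \<open>D\<close> is
        added at once, so that the extension is a complete pendent path and the condition in
        \<open>good\<close> is kept.\<close>
      have "\<exists>e2\<in>E. u \<in> e2 \<and> e2 \<noteq> e"
      proof (rule ccontr)
        assume "\<not> (\<exists>e2\<in>E. u \<in> e2 \<and> e2 \<noteq> e)"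
        moreover have "u \<in> e" using wu(1) by simp
        ultimately have "{e' \<in> E. u \<in> e'} = {e}" using e(1) by blast
        then show False using D2[OF True] by (simp add: degree_def)
      qed
      then obtain e2 where e2: "e2 \<in> E" "u \<in> e2" "e2 \<noteq> e" by blast
      obtain a b where ab: "e2 = {a, b}" "a \<noteq> b" using G e2(1) by (auto simp: simple_graph_def)
      define v where "v = (if u = a then b else a)"
      have v: "e2 = {u, v}" "u \<noteq> v" using ab e2(2) by (auto simp: v_def)
      have vw: "v \<noteq> w" using v e2(3) wu(1) by auto
      have vV: "v \<in> V" using simple_graphD(3)[OF G e2(1)] v by auto
      have vD: "v \<notin> D" using DD[OF e2(1)] v True by auto
      \<comment> \<open>Otherwise the edge \<open>{u, v}\<close> would join two vertices of the
        connected graph already enlarged by \<open>{w, u}\<close> and close a second cycle.\<close>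
      have "v \<notin> V0"
      proof
        assume "v \<in> V0"
        have new: "{u, v} \<notin> insert {w, u} E0"
          using vw v(2) inV0[of "{u, v}"] wu(4) by (auto simp: doubleton_eq_iff)
        have sub1: "C \<subseteq> insert {w, u} E0" "insert {w, u} E0 \<subseteq> E" "{u, v} \<in> E"
          using G0(3) E0 e(1) wu(1) e2(1) v(1) by auto
        show False
          by (rule no_new[OF connected_graph_add_leaf[OF conn0 wu(3)] sub1 new])
            (use v \<open>v \<in> V0\<close> in auto)
      qed
      then have "grown D W C (Suc p) q (insert v (insert u V0)) (insert {u, v} (insert {w, u} E0))"
        using grown.path[OF gr wu(3) wD wu(4) True] v vD by auto
      moreover have "\<forall>e'\<in>E. e' \<inter> D \<inter> insert v (insert u V0) \<noteq> {} \<longrightarrow> e' \<in> insert {u, v} (insert {w, u} E0)"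
      proof (intro ballI impI)
        fix e' assume e': "e' \<in> E" "e' \<inter> D \<inter> insert v (insert u V0) \<noteq> {}"
        show "e' \<in> insert {u, v} (insert {w, u} E0)"
        proof (cases "u \<in> e'")
          case u: True
          have "{f \<in> E. u \<in> f} = {e, e2}"
            using deg2_edges[OF G D2[OF True] e(1) e2(1)] e2 wu(1) by simp
          then have "e' = e \<or> e' = e2" using u e'(1) by blast
          then show ?thesis using v(1) wu(1) by fast
        next
          case False
          then have "e' \<inter> D \<inter> V0 \<noteq> {}" using e' vD by auto
          then show ?thesis using closed[OF e'(1)] by simp
        qed
      qed
      ultimately have "good (insert v (insert u V0))"
        using E0 e(1) wu(1) uV sub vV e2(1) v(1)
        by (intro goodI[of "Suc p" q _ "insert {u, v} (insert {w, u} E0)"]) simp_all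
      then show False using V0(2)[of "insert v (insert u V0)"] finV0 wu(4) \<open>v \<notin> V0\<close> v(2) by simp
    qed
  qed
  then have VV: "V0 = V" using sub by auto
  have "E \<subseteq> E0"
  proof
    fix e assume e: "e \<in> E"
    obtain a b where ab: "e = {a, b}" "a \<noteq> b" "a \<in> V" "b \<in> V" using G e(1) by (auto simp: simple_graph_def)
    show "e \<in> E0"
    proof (rule ccontr)
      assume "e \<notin> E0"
      then show False
        by (intro no_new[OF conn0 G0(3) E0, of a b]) (use ab e VV in simp_all)
    qed
  qed
  then have "E0 = E" using E0 by auto
  then show ?thesis using gr VV by auto
qed

subsection \<open>Bounds for weighted cycles\<close>

text \<open>The ratio of the sum to its last product changes from \<open>R\<close> to
  \<open>R / w + 1\<close> when a factor \<open>w\<close> is appended. A factor at least 2 brings a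
  ratio of at most 4 down to at most 3, a factor at least 1 turns at most 3 into at most 4, and two
  positions in \<open>B\<close> are never adjacent.\<close>

lemma prefix_products_le:
  fixes w :: "nat \<Rightarrow> nat"
  assumes "\<And>t. B t \<Longrightarrow> \<not> B (Suc t)" "\<And>t. 1 \<le> w t" "\<And>t. \<not> B t \<Longrightarrow> 2 \<le> w t"
  shows "(\<Sum>k=1..Suc m. \<Prod>t=i..<i + k. w t) \<le> (if B (i + m) then 4 else 3) * (\<Prod>t=i..<i + Suc m. w t)"
proof (induction m)
  case 0
  then show ?case by simp
next
  case (Suc m)
  define p where "p = (\<Prod>t=i..<i + Suc m. w t)"
  define s where "s = (\<Sum>k=1..Suc m. \<Prod>t=i..<i + k. w t)"
  have IH: "s \<le> (if B (i + m) then 4 else 3) * p" using Suc by (simp add: s_def p_def)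
  have p': "(\<Prod>t=i..<i + Suc (Suc m). w t) = p * w (i + Suc m)" by (simp add: p_def)
  have s': "(\<Sum>k=1..Suc (Suc m). \<Prod>t=i..<i + k. w t) = s + p * w (i + Suc m)"
    by (simp add: s_def p_def)
  show ?case
  proof (cases "B (i + Suc m)")
    case True
    then have "\<not> B (i + m)" using assms(1)[of "i + m"] by auto
    then have "s \<le> 3 * p" using IH by simp
    also have "\<dots> \<le> 3 * (p * w (i + Suc m))" using assms(2)[of "i + Suc m"] by simp
    finally show ?thesis using True unfolding s' p' by simp
  next
    case False
    define r where "r = p * w (i + Suc m)"
    have "p * 2 \<le> r" unfolding r_def by (rule mult_le_mono2[OF assms(3)[OF False]])
    moreover have "s \<le> 4 * p" using IH by (auto split: if_splits)
    ultimately show ?thesis using False unfolding s' p' r_def[symmetric] by simp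
  qed
qed

text \<open>The same recursion for the ratio, with 2 as the fixed point of
  \<open>R / 2 + 1\<close>.\<close>

lemma prefix_products_le_double:
  fixes w :: "nat \<Rightarrow> nat"
  assumes "\<And>t. 2 \<le> w t"
  shows "(\<Sum>k=1..Suc m. \<Prod>t=i..<i + k. w t) \<le> 2 * (\<Prod>t=i..<i + Suc m. w t)"
proof (induction m)
  case (Suc m)
  define p where "p = (\<Prod>t=i..<i + Suc m. w t)"
  define r where "r = p * w (i + Suc m)"
  have "p * 2 \<le> r" unfolding r_def by (rule mult_le_mono2[OF assms])
  moreover have "(\<Prod>t=i..<i + Suc (Suc m). w t) = r" by (simp add: r_def p_def)
  ultimately show ?case using Suc unfolding p_def[symmetric] by simp
qed simp

lemma triple_bounds:
  fixes x y z :: nat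
  assumes "2 \<le> x" "2 \<le> y" "2 \<le> z"
  shows "8 \<le> x * y * z" "4 * x \<le> x * y * z" "4 * y \<le> x * y * z" "4 * z \<le> x * y * z"
    "2 * (x * y) \<le> x * y * z" "2 * (y * z) \<le> x * y * z" "2 * (x * z) \<le> x * y * z"
proof -
  have xy: "2 * 2 \<le> x * y" "2 * 2 \<le> y * z" "2 * 2 \<le> x * z"
    by (rule mult_le_mono[OF assms(1,2)], rule mult_le_mono[OF assms(2,3)], rule mult_le_mono[OF assms(1,3)])
  have "2 * 2 * 2 \<le> x * y * z" by (rule mult_le_mono[OF xy(1) assms(3)])
  then show "8 \<le> x * y * z" by simp
  have "x * (2 * 2) \<le> x * (y * z)" "y * (2 * 2) \<le> y * (x * z)" "z * (2 * 2) \<le> z * (x * y)"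
    using mult_le_mono2[OF xy(2)] mult_le_mono2[OF xy(3)] mult_le_mono2[OF xy(1)] by blast+
  then show "4 * x \<le> x * y * z" "4 * y \<le> x * y * z" "4 * z \<le> x * y * z"
    by (simp_all only: mult_ac numeral_times_numeral num_double semiring_norm)
  have "x * y * 2 \<le> x * y * z" "y * z * 2 \<le> y * z * x" "x * z * 2 \<le> x * z * y"
    using assms by (blast intro: mult_le_mono2)+
  then show "2 * (x * y) \<le> x * y * z" "2 * (y * z) \<le> x * y * z" "2 * (x * z) \<le> x * y * z"
    by (simp_all only: mult_ac)
qed

text \<open>The weighted count of a 4-cycle with weights in cyclic order. The full product occurs
  four times, once for each omitted edge; \<open>cyc5\<close> is the analogue for the
  5-cycle.\<close>

definition cyc4 :: "nat \<Rightarrow> nat \<Rightarrow> nat \<Rightarrow> nat \<Rightarrow> nat" where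
  "cyc4 a b c d = a + b + c + d + a*b + b*c + c*d + d*a + a*b*c + b*c*d + c*d*a + d*a*b + 4*a*b*c*d"

definition cyc5 :: "nat \<Rightarrow> nat \<Rightarrow> nat \<Rightarrow> nat \<Rightarrow> nat \<Rightarrow> nat" where
  "cyc5 a b c d e = a + b + c + d + e + a*b + b*c + c*d + d*e + e*a
    + a*b*c + b*c*d + c*d*e + d*e*a + e*a*b
    + a*b*c*d + b*c*d*e + c*d*e*a + d*e*a*b + e*a*b*c + 5*a*b*c*d*e"

lemma cyc4_rotate: "cyc4 a b c d = cyc4 b c d a"
  by (simp add: cyc4_def algebra_simps)

lemma cyc5_rotate: "cyc5 a b c d e = cyc5 b c d e a"
  by (simp add: cyc5_def algebra_simps)

lemma cyc4_le:
  assumes "2 \<le> x" "2 \<le> y" "2 \<le> z"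
  shows "cyc4 1 x y z \<le> 9 * (x * y * z)"
proof -
  have "cyc4 1 x y z = 1 + 2 * x + y + 2 * z + 2 * (x * y) + 2 * (y * z) + x * z + 5 * (x * y * z)"
    by (simp add: cyc4_def algebra_simps)
  \<comment> \<open>The terms of degree below 3 add up to at most 31/8 times
    \<open>x * y * z\<close>.\<close>
  then show ?thesis using triple_bounds[OF assms] by linarith
qed

lemma cyc5_le:
  assumes "2 \<le> x" "2 \<le> y" "2 \<le> z"
  shows "cyc5 1 x 1 y z \<le> 15 * (x * y * z)"
proof -
  have "cyc5 1 x 1 y z = 2 + 4 * x + 2 * y + 2 * z + 2 * (x * y) + 2 * (x * z) + 4 * (y * z) + 7 * (x * y * z)"
    by (simp add: cyc5_def algebra_simps)
  \<comment> \<open>Here the terms of degree below 3 add up to at most 25/4 times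
    \<open>x * y * z\<close>.\<close>
  then show ?thesis using triple_bounds[OF assms] by linarith
qed

section \<open>Upper bounds and small cases of the weighted count on a cycle\<close>

context cycle_walk
begin

lemma sum_window: "(\<Sum>t=s..<s + n. h (c t)) = (\<Sum>v\<in>verts. h v)"
  unfolding verts_window[of s, symmetric] by (simp add: sum.reindex[OF inj_on_window])

lemma card_verts_Int: "card (verts \<inter> D) = (\<Sum>t=s..<s + n. if c t \<in> D then 1 else 0)"
proof -
  have "finite verts" by (simp add: verts_def)
  then have "card (verts \<inter> D) = (\<Sum>v\<in>verts. if v \<in> D then 1 else 0)"
    by (simp add: sum.inter_restrict[symmetric])
  then show ?thesis unfolding sum_window[of "\<lambda>v. if v \<in> D then 1 else (0::nat)" s, symmetric] .
qed

text \<open>For each \<open>t\<close> exactly one of three things happens: the edge at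
  \<open>t\<close> avoids \<open>D\<close>, or its first vertex is in \<open>D\<close>, or its
  second. Every vertex of \<open>D\<close> is seen once as a first and once as a second
  vertex.\<close>

lemma card_free_edges:
  assumes "\<And>e. e \<in> edges \<Longrightarrow> \<not> e \<subseteq> D"
  shows "card {e\<in>edges. e \<inter> D = {}} + 2 * card (verts \<inter> D) = n"
proof -
  have nadj: "\<not> (c t \<in> D \<and> c (Suc t) \<in> D)" for t using assms[OF edge_in_edges, of t] unfolding edge_def by simp
  have inj: "inj_on edge {..<n}" by (rule inj_onI) (simp add: edge_eq_iff)
  have "{e\<in>edges. e \<inter> D = {}} = edge ` {t\<in>{..<n}. c t \<notin> D \<and> c (Suc t) \<notin> D}"
    by (auto simp: edges_def edge_def)
  then have "card {e\<in>edges. e \<inter> D = {}} = card {t\<in>{..<n}. c t \<notin> D \<and> c (Suc t) \<notin> D}"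
    by (simp add: card_image[OF inj_on_subset[OF inj]] subset_iff)
  also have "\<dots> = (\<Sum>t<n. if c t \<notin> D \<and> c (Suc t) \<notin> D then 1 else 0)"
    by (simp flip: sum.inter_filter)
  finally have 1: "card {e\<in>edges. e \<inter> D = {}} = (\<Sum>t<n. if c t \<notin> D \<and> c (Suc t) \<notin> D then 1 else 0)" .
  have 2: "card (verts \<inter> D) = (\<Sum>t<n. if c t \<in> D then 1 else 0)"
    using card_verts_Int[of D 0] by (simp add: atLeast0LessThan)
  have "card (verts \<inter> D) = (\<Sum>t=Suc 0..<Suc n. if c t \<in> D then 1 else 0)"
    using card_verts_Int[of D "Suc 0"] by simp
  then have 3: "card (verts \<inter> D) = (\<Sum>t<n. if c (Suc t) \<in> D then 1 else 0)"
    unfolding sum.shift_bounds_Suc_ivl by (simp add: atLeast0LessThan)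
  have "card {e\<in>edges. e \<inter> D = {}} + card (verts \<inter> D) + card (verts \<inter> D)
    = (\<Sum>t<n. (if c t \<notin> D \<and> c (Suc t) \<notin> D then 1 else 0) + (if c t \<in> D then 1 else 0)
        + (if c (Suc t) \<in> D then 1 else 0))"
    unfolding sum.distrib using 1 2 3 by metis
  also have "\<dots> = (\<Sum>t<n. 1)" by (rule sum.cong[OF refl]) (use nadj in auto)
  finally show ?thesis by simp
qed

lemma wtrees_cycle_le_double:
  assumes "\<And>v. v \<in> verts \<Longrightarrow> 2 \<le> f v"
  shows "wtrees verts edges f \<le> 2 * n * (\<Prod>v\<in>verts. f v)"
proof -
  obtain m where m: "n = Suc m" using n3 by (cases n) auto
  have "wtrees verts edges f \<le> (\<Sum>i<n. 2 * (\<Prod>v\<in>verts. f v))"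
    unfolding wtrees_cycle
  proof (rule sum_mono)
    fix i
    show "(\<Sum>k=1..n. \<Prod>t=i..<i + k. f (c t)) \<le> 2 * (\<Prod>v\<in>verts. f v)"
      using prefix_products_le_double[of "\<lambda>t. f (c t)" i m, OF assms[OF c_in_verts]]
      unfolding m[symmetric] prod_window .
  qed
  then show ?thesis by simp
qed

text \<open>The arcs are grouped by their starting vertex. A group contributes at most 3 full
  products, or 4 if the last vertex of the full arc is in \<open>D\<close>; every cycle vertex is
  that last vertex for exactly one start.\<close>

lemma wtrees_cycle_le:
  assumes f1: "\<And>v. v \<in> verts \<Longrightarrow> 1 \<le> f v" and f2: "\<And>v. v \<in> verts - D \<Longrightarrow> 2 \<le> f v"
    and DD: "\<And>e. e \<in> edges \<Longrightarrow> \<not> e \<subseteq> D"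
  shows "wtrees verts edges f \<le> (3 * n + card (verts \<inter> D)) * (\<Prod>v\<in>verts. f v)"
proof -
  obtain m where m: "n = Suc m" using n3 by (cases n) auto
  define A where "A = (\<Prod>v\<in>verts. f v)"
  have nadj: "c (Suc t) \<notin> D" if "c t \<in> D" for t using DD[OF edge_in_edges, of t] that unfolding edge_def by simp
  have "wtrees verts edges f \<le> (\<Sum>i<n. (if c (i + m) \<in> D then 4 else 3) * A)"
    unfolding wtrees_cycle
  proof (rule sum_mono)
    fix i
    have "(\<Sum>k=1..Suc m. \<Prod>t=i..<i + k. f (c t))
      \<le> (if c (i + m) \<in> D then 4 else 3) * (\<Prod>t=i..<i + Suc m. f (c t))"
      by (rule prefix_products_le[where B="\<lambda>t. c t \<in> D"]) (use nadj f1 f2 in simp_all)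
    then show "(\<Sum>k=1..n. \<Prod>t=i..<i + k. f (c t)) \<le> (if c (i + m) \<in> D then 4 else 3) * A"
      unfolding A_def m[symmetric] prod_window .
  qed
  also have "\<dots> = (\<Sum>i<n. 3 + (if c (i + m) \<in> D then 1 else 0)) * A"
    unfolding sum_distrib_right by (rule sum.cong) auto
  also have "(\<Sum>i<n. 3 + (if c (i + m) \<in> D then 1 else (0::nat))) = 3 * n + (\<Sum>i<n. if c (i + m) \<in> D then 1 else 0)"
    unfolding sum.distrib by simp
  also have "(\<Sum>i<n. if c (i + m) \<in> D then 1 else (0::nat)) = (\<Sum>t=0 + m..<n + m. if c t \<in> D then 1 else 0)"
    unfolding sum.shift_bounds_nat_ivl by (simp add: atLeast0LessThan)
  also have "\<dots> = card (verts \<inter> D)"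
    unfolding card_verts_Int[of D m] by (simp add: add.commute)
  finally show ?thesis unfolding A_def .
qed

lemma wtrees_cycle3:
  assumes "n = 3"
  shows "wtrees verts edges f = f (c 0) + f (c 1) + f (c 2) + f (c 0) * f (c 1) + f (c 1) * f (c 2)
    + f (c 2) * f (c 0) + 3 * (f (c 0) * f (c 1) * f (c 2))"
proof -
  have c: "c 3 = c 0" "c 4 = c 1" using assms by (simp_all add: c_eq_iff)
  show ?thesis unfolding wtrees_cycle unfolding assms using c
    by (simp add: numeral_eq_Suc sum.cl_ivl_Suc prod.op_ivl_Suc algebra_simps)
qed

lemma prod_verts: "(\<Prod>v\<in>verts. f v) = (\<Prod>t<n. f (c t))"
  using prod_window[of f 0] by (simp add: atLeast0LessThan)

lemma wtrees_cycle4: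
  assumes "n = 4"
  shows "wtrees verts edges f = cyc4 (f (c 0)) (f (c 1)) (f (c 2)) (f (c 3))"
proof -
  have c: "c 4 = c 0" "c 5 = c 1" "c 6 = c 2" using assms by (simp_all add: c_eq_iff)
  show ?thesis unfolding wtrees_cycle cyc4_def unfolding assms using c
    by (simp add: numeral_eq_Suc sum.cl_ivl_Suc prod.op_ivl_Suc algebra_simps)
qed

lemma wtrees_cycle5:
  assumes "n = 5"
  shows "wtrees verts edges f = cyc5 (f (c 0)) (f (c 1)) (f (c 2)) (f (c 3)) (f (c 4))"
proof -
  have c: "c 5 = c 0" "c 6 = c 1" "c 7 = c 2" "c 8 = c 3" using assms by (simp_all add: c_eq_iff)
  show ?thesis unfolding wtrees_cycle cyc5_def unfolding assms using c
    by (simp add: numeral_eq_Suc sum.cl_ivl_Suc prod.op_ivl_Suc algebra_simps)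
qed

end

text \<open>Two numbers with given product and lower bound \<open>y\<close> have the largest sum
  when one equals \<open>y\<close>; this is \<open>0 \<le> (a - y) * (b - y)\<close> over the
  integers.\<close>

lemma add_le_of_mult_eq:
  fixes a b x y :: nat
  assumes "y \<le> a" "y \<le> b" "a * b = x * y" "0 < y"
  shows "a + b \<le> x + y"
proof -
  obtain a' b' where ab: "a = y + a'" "b = y + b'" using assms by (auto simp: le_iff_add)
  have "y * (a + b) \<le> a * b + y * y" unfolding ab by (simp add: algebra_simps)
  also have "\<dots> = y * (x + y)" using assms(3) by (simp add: algebra_simps)
  finally show ?thesis using assms(4) by simp
qed

text \<open>The requirements on \<open>K\<close> in \<open>wtrees_cycle_factor\<close>, with
  \<open>n\<close> in the role of \<open>c1\<close>: the first two for \<open>c2 = 0\<close> and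
  \<open>K = 2 * n\<close>, the others for \<open>c2 = 1\<close> and
  \<open>K = 3 * n + 7\<close>.\<close>

lemma linear_le_power2:
  assumes "3 \<le> n"
  shows "18 * n \<le> 8 * (2::nat) ^ n" "12 * n \<le> 5 * (2::nat) ^ n"
    "9 * (3 * n + 7) \<le> 24 * (2::nat) ^ n" "6 * (3 * n + 7) \<le> 15 * (2::nat) ^ n"
  using assms by (induction n rule: dec_induct) auto

text \<open>The requirement \<open>9 * K \<le> 8 * (3 ^ c2 * 2 ^ c1)\<close> for
  \<open>c2 = 2\<close> and \<open>K = 3 * n + 14\<close>.\<close>

lemma linear_le_power2_from2: "2 \<le> n \<Longrightarrow> 9 * (3 * n + 14) \<le> 72 * (2::nat) ^ n"
  by (induction n rule: dec_induct) auto

lemma linear_le_power2_from4: "4 \<le> n \<Longrightarrow> 64 * n \<le> 17 * (2::nat) ^ n"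
  by (induction n rule: dec_induct) auto

lemma linear_le_power3: "3 \<le> n \<Longrightarrow> 9 * n \<le> (3::nat) ^ n"
  by (induction n rule: dec_induct) auto

lemma Suc_le_power2: "n + 1 \<le> (2::nat) ^ n"
  by (induction n) auto

context cycle_walk
begin

text \<open>The bound \<open>wtrees_cycle_le\<close> gives \<open>K = 3 * c1 + 7 * c2\<close>. This is too large if no vertex
  is in \<open>D\<close>, where \<open>wtrees_cycle_le_double\<close> takes over, and for the 4-cycle with one vertex in \<open>D\<close>
  and the 5-cycle with two, where the explicit polynomials are used. The three conditions on \<open>K\<close> are exactly
  what the comparison with the extremal graph needs: in \<open>cycle_bound_two\<close> for \<open>y = 2\<close>, in
  \<open>cycle_bound_one\<close>, and in \<open>cycle_bound_two\<close> for \<open>y = 3\<close>.\<close>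
lemma wtrees_cycle_factor:
  assumes f1: "\<And>v. v \<in> verts \<inter> D \<Longrightarrow> f v = 1" and f2: "\<And>v. v \<in> verts - D \<Longrightarrow> 2 \<le> f v"
    and DD: "\<And>e. e \<in> edges \<Longrightarrow> \<not> e \<subseteq> D"
    and c1: "c1 = card {e\<in>edges. e \<inter> D = {}}" and c2: "c2 = card (verts \<inter> D)" and "3 \<le> c1 + c2"
  shows "\<exists>K. wtrees verts edges f \<le> K * (\<Prod>v\<in>verts. f v) \<and> 9 * K \<le> 8 * (3 ^ c2 * 2 ^ c1) \<and>
    (c2 \<le> 1 \<longrightarrow> 6 * K \<le> 5 * (3 ^ c2 * 2 ^ c1)) \<and> (c1 = 0 \<longrightarrow> 27 * K \<le> 22 * 3 ^ c2)"
proof -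
  have n: "n = c1 + 2 * c2" using card_free_edges[OF DD] c1 c2 by simp
  have f1': "1 \<le> f v" if "v \<in> verts" for v using f1[of v] f2[of v] that by (cases "v \<in> D") auto
  have fc1: "f (c t) = 1" if "c t \<in> D" for t using f1 that by simp
  have fc2: "2 \<le> f (c t)" if "c t \<notin> D" for t using f2 that by simp
  have nadj: "c (Suc t) \<notin> D" if "c t \<in> D" for t using DD[OF edge_in_edges, of t] that unfolding edge_def by simp
  have c2': "c2 = (\<Sum>t<n. if c t \<in> D then 1 else 0)"
    using card_verts_Int[of D 0] c2 by (simp add: atLeast0LessThan)
  have gen: "wtrees verts edges f \<le> (3 * c1 + 7 * c2) * (\<Prod>v\<in>verts. f v)"
  proof -
    have "3 * n + card (verts \<inter> D) = 3 * c1 + 7 * c2" using n c2 by linarith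
    then show ?thesis using wtrees_cycle_le[of f D, OF f1' f2 DD] by metis
  qed
  consider "c2 = 0" | "c2 = 1" "c1 = 2" | "c2 = 2" "c1 = 1" | "c2 = 1" "3 \<le> c1" | "c2 = 2" "2 \<le> c1" | "3 \<le> c2"
    using assms(6) by linarith
  then show ?thesis
  proof cases
    case 1
    have "verts \<inter> D = {}"
    proof -
      have "finite verts" by (simp add: verts_def)
      then show ?thesis using 1 c2 by (metis card_0_eq finite_Int)
    qed
    then have "wtrees verts edges f \<le> 2 * n * (\<Prod>v\<in>verts. f v)"
      by (intro wtrees_cycle_le_double f2) auto
    moreover have "n = c1" using n 1 by simp
    ultimately show ?thesis using linear_le_power2[OF n3] 1 n3 by (intro exI[of _ "2 * n"]) simp
  next
    case 2
    then have n4: "n = 4" using n by simp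
    have s: "(if c 0 \<in> D then 1 else 0) + (if c 1 \<in> D then 1 else 0) + (if c 2 \<in> D then 1 else 0)
      + (if c 3 \<in> D then 1 else 0) = (1::nat)"
      using c2' 2 n4 by (simp add: numeral_eq_Suc)
    have A: "(\<Prod>v\<in>verts. f v) = f (c 0) * f (c 1) * f (c 2) * f (c 3)"
      unfolding prod_verts unfolding n4 by (simp add: numeral_eq_Suc)
    have "cyc4 (f (c 0)) (f (c 1)) (f (c 2)) (f (c 3)) \<le> 9 * (f (c 0) * f (c 1) * f (c 2) * f (c 3))"
    proof -
      consider "c 0 \<in> D" "c 1 \<notin> D" "c 2 \<notin> D" "c 3 \<notin> D" | "c 0 \<notin> D" "c 1 \<in> D" "c 2 \<notin> D" "c 3 \<notin> D"
        | "c 0 \<notin> D" "c 1 \<notin> D" "c 2 \<in> D" "c 3 \<notin> D" | "c 0 \<notin> D" "c 1 \<notin> D" "c 2 \<notin> D" "c 3 \<in> D"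
        using s by (cases "c 0 \<in> D"; cases "c 1 \<in> D"; cases "c 2 \<in> D"; cases "c 3 \<in> D"; simp)
      then show ?thesis
      proof cases
        case 1
        then show ?thesis using cyc4_le[of "f (c 1)" "f (c 2)" "f (c 3)"] fc1 fc2 by simp
      next
        case 2
        then show ?thesis using cyc4_le[of "f (c 2)" "f (c 3)" "f (c 0)"] fc1 fc2
          cyc4_rotate[of "f (c 0)" 1 "f (c 2)" "f (c 3)"] by (simp add: mult_ac)
      next
        case 3
        then show ?thesis using cyc4_le[of "f (c 3)" "f (c 0)" "f (c 1)"] fc1 fc2
          cyc4_rotate[of "f (c 0)" "f (c 1)" 1 "f (c 3)"] cyc4_rotate[of "f (c 1)" 1 "f (c 3)" "f (c 0)"]
          by (simp add: mult_ac)
      next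
        case 4
        then show ?thesis using cyc4_le[of "f (c 0)" "f (c 1)" "f (c 2)"] fc1 fc2
          cyc4_rotate[of 1 "f (c 0)" "f (c 1)" "f (c 2)"] by (simp add: mult_ac)
      qed
    qed
    then have "wtrees verts edges f \<le> 9 * (\<Prod>v\<in>verts. f v)" unfolding wtrees_cycle4[OF n4] A .
    then show ?thesis using 2 by (intro exI[of _ 9]) simp
  next
    case 3
    then have n5: "n = 5" using n by simp
    then have c5: "c 5 = c 0" by (simp add: c_eq_iff)
    have s: "(if c 0 \<in> D then 1 else 0) + (if c 1 \<in> D then 1 else 0) + (if c 2 \<in> D then 1 else 0)
      + (if c 3 \<in> D then 1 else 0) + (if c 4 \<in> D then 1 else 0) = (2::nat)"
      using c2' 3 n5 by (simp add: numeral_eq_Suc)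
    have na: "\<not> (c 0 \<in> D \<and> c 1 \<in> D)" "\<not> (c 1 \<in> D \<and> c 2 \<in> D)" "\<not> (c 2 \<in> D \<and> c 3 \<in> D)"
      "\<not> (c 3 \<in> D \<and> c 4 \<in> D)" "\<not> (c 4 \<in> D \<and> c 0 \<in> D)"
      using nadj[of 0] nadj[of 1] nadj[of 2] nadj[of 3] nadj[of 4] c5 by (auto simp: numeral_eq_Suc)
    have A: "(\<Prod>v\<in>verts. f v) = f (c 0) * f (c 1) * f (c 2) * f (c 3) * f (c 4)"
      unfolding prod_verts unfolding n5 by (simp add: numeral_eq_Suc)
    have le: "cyc5 1 (f (c i)) 1 (f (c j)) (f (c k)) \<le> 15 * (f (c i) * f (c j) * f (c k))"
      if "c i \<notin> D" "c j \<notin> D" "c k \<notin> D" for i j k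
      using cyc5_le fc2 that by blast
    have "cyc5 (f (c 0)) (f (c 1)) (f (c 2)) (f (c 3)) (f (c 4))
      \<le> 15 * (f (c 0) * f (c 1) * f (c 2) * f (c 3) * f (c 4))"
    proof -
      \<comment> \<open>The five rotations of the only way to place two nonadjacent vertices on a
        5-cycle.\<close>
      consider "c 0 \<in> D" "c 2 \<in> D" "c 1 \<notin> D" "c 3 \<notin> D" "c 4 \<notin> D"
        | "c 1 \<in> D" "c 3 \<in> D" "c 2 \<notin> D" "c 4 \<notin> D" "c 0 \<notin> D"
        | "c 2 \<in> D" "c 4 \<in> D" "c 3 \<notin> D" "c 0 \<notin> D" "c 1 \<notin> D"
        | "c 3 \<in> D" "c 0 \<in> D" "c 4 \<notin> D" "c 1 \<notin> D" "c 2 \<notin> D"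
        | "c 4 \<in> D" "c 1 \<in> D" "c 0 \<notin> D" "c 2 \<notin> D" "c 3 \<notin> D"
        using s na
        by (cases "c 0 \<in> D"; cases "c 1 \<in> D"; cases "c 2 \<in> D"; cases "c 3 \<in> D"; cases "c 4 \<in> D"; simp)
      then show ?thesis
      proof cases
        case 1
        then show ?thesis using le[of 1 3 4] fc1 by simp
      next
        case 2
        then show ?thesis using le[of 2 4 0] fc1 cyc5_rotate[of "f (c 0)" 1 "f (c 2)" 1 "f (c 4)"]
          by (simp add: mult_ac)
      next
        case 3
        then show ?thesis using le[of 3 0 1] fc1 cyc5_rotate[of "f (c 0)" "f (c 1)" 1 "f (c 3)" 1]
          cyc5_rotate[of "f (c 1)" 1 "f (c 3)" 1 "f (c 0)"] by (simp add: mult_ac)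
      next
        case 4
        then show ?thesis using le[of 4 1 2] fc1 cyc5_rotate[of 1 "f (c 4)" 1 "f (c 1)" "f (c 2)"]
          cyc5_rotate[of "f (c 4)" 1 "f (c 1)" "f (c 2)" 1] by (simp add: mult_ac)
      next
        case 5
        then show ?thesis using le[of 0 2 3] fc1 cyc5_rotate[of 1 "f (c 0)" 1 "f (c 2)" "f (c 3)"]
          by (simp add: mult_ac)
      qed
    qed
    then have "wtrees verts edges f \<le> 15 * (\<Prod>v\<in>verts. f v)" unfolding wtrees_cycle5[OF n5] A .
    then show ?thesis using 3 by (intro exI[of _ 15]) simp
  next
    case 4
    then show ?thesis using gen linear_le_power2[OF 4(2)] 4
      by (intro exI[of _ "3 * c1 + 7 * c2"]) simp
  next
    case 5
    then show ?thesis using gen linear_le_power2_from2[OF 5(2)] 5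
      by (intro exI[of _ "3 * c1 + 7 * c2"]) simp
  next
    case 6
    \<comment> \<open>This estimate leaves room for all \<open>c1\<close>. For \<open>c1 = 0\<close>
      the last requirement reads \<open>27 * 7 * c2 \<le> 22 * 3 ^ c2\<close>, and
      \<open>9 * c2 \<le> 3 ^ c2\<close> gives 198 on the right against 189 on the left, each times
      \<open>c2\<close>.\<close>
    have P0: "9 * c2 * (c1 + 1) \<le> 3 ^ c2 * 2 ^ c1"
      by (rule mult_le_mono[OF linear_le_power3[OF 6] Suc_le_power2])
    have "9 * c2 * (c1 + 1) = 9 * (c1 * c2) + 9 * c2" by (simp add: algebra_simps)
    note P = mult_le_mono2[OF 6, of c1] P0[unfolded this]
    have "9 * (3 * c1 + 7 * c2) \<le> 9 * (c1 * 3) + 72 * c2" by simp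
    also have "\<dots> \<le> 9 * (c1 * c2) + 72 * c2" by (rule add_right_mono[OF mult_le_mono2[OF P(1)]])
    also have "\<dots> \<le> 8 * (9 * (c1 * c2) + 9 * c2)" by simp
    also have "\<dots> \<le> 8 * (3 ^ c2 * 2 ^ c1)" by (rule mult_le_mono2[OF P(2)])
    finally have "9 * (3 * c1 + 7 * c2) \<le> 8 * (3 ^ c2 * 2 ^ c1)" .
    then show ?thesis using gen 6 linear_le_power3[OF 6]
      by (intro exI[of _ "3 * c1 + 7 * c2"]) auto
  qed
qed

text \<open>The shape of the extremal cycle for one segment of length 2. Once the product of the two
  free weights is fixed, the count depends only on their sum.\<close>

lemma wtrees_cycle3_one:
  assumes "n = 3" and f1: "\<And>v. v \<in> verts \<inter> D \<Longrightarrow> f v = 1" and c2: "card (verts \<inter> D) = 1"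
  obtains i j where "c i \<notin> D" "c j \<notin> D" "(\<Prod>v\<in>verts. f v) = f (c i) * f (c j)"
    "wtrees verts edges f = 4 * (f (c i) * f (c j)) + 2 * f (c i) + 2 * f (c j) + 1"
proof -
  have fc1: "f (c t) = 1" if "c t \<in> D" for t using f1 that by simp
  have s: "(if c 0 \<in> D then 1 else 0) + (if c 1 \<in> D then 1 else 0) + (if c 2 \<in> D then 1 else 0) = (1::nat)"
    using card_verts_Int[of D 0] c2 assms(1) by (simp add: numeral_eq_Suc)
  have A: "(\<Prod>v\<in>verts. f v) = f (c 0) * f (c 1) * f (c 2)"
    unfolding prod_verts unfolding assms(1) by (simp add: numeral_eq_Suc)
  consider "c 0 \<in> D" "c 1 \<notin> D" "c 2 \<notin> D" | "c 0 \<notin> D" "c 1 \<in> D" "c 2 \<notin> D"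
    | "c 0 \<notin> D" "c 1 \<notin> D" "c 2 \<in> D"
    using s by (cases "c 0 \<in> D"; cases "c 1 \<in> D"; cases "c 2 \<in> D"; simp)
  then show ?thesis
  proof cases
    case 1
    then show ?thesis using that[of 1 2] fc1 A wtrees_cycle3[OF assms(1), of f] by simp
  next
    case 2
    then show ?thesis using that[of 0 2] fc1 A wtrees_cycle3[OF assms(1), of f] by simp
  next
    case 3
    then show ?thesis using that[of 0 1] fc1 A wtrees_cycle3[OF assms(1), of f] by simp
  qed
qed

text \<open>Nonadjacency makes the two vertices of weight 1 opposite, so the other two weights enter
  symmetrically, through their product and their sum.\<close>

lemma wtrees_cycle4_two:
  assumes "n = 4" and f1: "\<And>v. v \<in> verts \<inter> D \<Longrightarrow> f v = 1" and c2: "card (verts \<inter> D) = 2"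
    and DD: "\<And>e. e \<in> edges \<Longrightarrow> \<not> e \<subseteq> D"
  obtains i j where "c i \<notin> D" "c j \<notin> D" "(\<Prod>v\<in>verts. f v) = f (c i) * f (c j)"
    "wtrees verts edges f = 6 * (f (c i) * f (c j)) + 4 * f (c i) + 4 * f (c j) + 2"
proof -
  have fc1: "f (c t) = 1" if "c t \<in> D" for t using f1 that by simp
  have s: "(if c 0 \<in> D then 1 else 0) + (if c 1 \<in> D then 1 else 0) + (if c 2 \<in> D then 1 else 0)
      + (if c 3 \<in> D then 1 else 0) = (2::nat)"
    using card_verts_Int[of D 0] c2 assms(1) by (simp add: numeral_eq_Suc)
  have nadj: "c (Suc t) \<notin> D" if "c t \<in> D" for t using DD[OF edge_in_edges, of t] that unfolding edge_def by simp
  have c4: "c 4 = c 0" using assms(1) by (simp add: c_eq_iff)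
  have na: "\<not> (c 0 \<in> D \<and> c 1 \<in> D)" "\<not> (c 1 \<in> D \<and> c 2 \<in> D)" "\<not> (c 2 \<in> D \<and> c 3 \<in> D)"
      "\<not> (c 3 \<in> D \<and> c 0 \<in> D)"
    using nadj[of 0] nadj[of 1] nadj[of 2] nadj[of 3] c4 by (auto simp: numeral_eq_Suc)
  have A: "(\<Prod>v\<in>verts. f v) = f (c 0) * f (c 1) * f (c 2) * f (c 3)"
    unfolding prod_verts unfolding assms(1) by (simp add: numeral_eq_Suc)
  consider "c 0 \<in> D" "c 1 \<notin> D" "c 2 \<in> D" "c 3 \<notin> D" | "c 0 \<notin> D" "c 1 \<in> D" "c 2 \<notin> D" "c 3 \<in> D"
    using s na by (cases "c 0 \<in> D"; cases "c 1 \<in> D"; cases "c 2 \<in> D"; cases "c 3 \<in> D"; simp)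
  then show ?thesis
  proof cases
    case 1
    then show ?thesis using that[of 1 3] fc1 A wtrees_cycle4[OF assms(1), of f] by (simp add: cyc4_def)
  next
    case 2
    then show ?thesis using that[of 0 2] fc1 A wtrees_cycle4[OF assms(1), of f] by (simp add: cyc4_def)
  qed
qed

section \<open>Comparison with the extremal value for at least two, one and no segments of length
  2\<close>

lemma cycle_bound_two:
  assumes f1: "\<And>v. v \<in> verts \<inter> D \<Longrightarrow> f v = 1" and f2: "\<And>v. v \<in> verts - D \<Longrightarrow> 2 \<le> f v"
    and f3: "\<And>v. q = 0 \<Longrightarrow> v \<in> verts - D \<Longrightarrow> 3 \<le> f v"
    and DD: "\<And>e. e \<in> edges \<Longrightarrow> \<not> e \<subseteq> D"
    and k: "k = card (verts \<inter> D) + p" "2 \<le> k" and r: "r = card {e\<in>edges. e \<inter> D = {}} + q"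
    and prod: "(\<Prod>v\<in>verts. f v) = 3 ^ p * 2 ^ q"
    and xy: "x * y = 3 ^ (k - 2) * 2 ^ r" "y = 2 \<or> y = 3 \<and> r = 0"
  shows "wtrees verts edges f + (3 * p + q) \<le> 6 * (x * y) + 4 * x + 4 * y + 2 + 3 * (k - 2) + r"
proof -
  define c1 where "c1 = card {e\<in>edges. e \<inter> D = {}}"
  define c2 where "c2 = card (verts \<inter> D)"
  define A where "A = (\<Prod>v\<in>verts. f v)"
  have n: "n = c1 + 2 * c2" using card_free_edges[OF DD] c1_def c2_def by simp
  have kr: "k = c2 + p" "r = c1 + q" using k r by (simp_all add: c1_def c2_def)
  \<comment> \<open>The product over all segments of length plus 1, evaluated for the given and for
    the extremal graph; the cycle of the latter carries two segments of length 2, whence the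
    9.\<close>
  have AN: "A * (3 ^ c2 * 2 ^ c1) = 9 * (x * y)"
  proof -
    have "A * (3 ^ c2 * 2 ^ c1) = 3 ^ k * 2 ^ r"
      unfolding A_def prod kr by (simp add: power_add mult_ac)
    moreover have "(3::nat) ^ (2 + (k - 2)) = 9 * 3 ^ (k - 2)" unfolding power_add by simp
    then have "(3::nat) ^ k = 9 * 3 ^ (k - 2)" unfolding le_add_diff_inverse[OF k(2)] .
    ultimately show ?thesis using xy(1) by simp
  qed
  consider "3 \<le> c1 + c2" | "c1 = 1" "c2 = 1" | "c1 = 0" "c2 = 2" using n n3 by linarith
  then show ?thesis
  proof cases
    case 1
    obtain K where K: "wtrees verts edges f \<le> K * A" "9 * K \<le> 8 * (3 ^ c2 * 2 ^ c1)"
        "c1 = 0 \<longrightarrow> 27 * K \<le> 22 * 3 ^ c2"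
      using wtrees_cycle_factor[of D f c1 c2, OF f1 f2 DD c1_def c2_def 1] unfolding A_def by blast
    show ?thesis
    proof (cases "y = 2")
      case True
      \<comment> \<open>For \<open>y = 2\<close> the terms \<open>6 * (x * y) + 4 * x\<close> of the
        target are \<open>8 * (x * y)\<close>, which is where the ratio 8/9 comes from.\<close>
      have "9 * (K * A) \<le> 8 * (A * (3 ^ c2 * 2 ^ c1))"
        using mult_le_mono2[OF K(2), of A] by (simp add: mult_ac)
      then have "K * A \<le> 8 * (x * y)" unfolding AN by linarith
      then show ?thesis using K(1) True kr k(2) by simp
    next
      case False
      then have y: "y = 3" "r = 0" using xy(2) by auto
      then have "c1 = 0" "q = 0" using kr by auto
      \<comment> \<open>For \<open>y = 3\<close> the same terms are \<open>22 * x\<close>, while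
        \<open>A * 3 ^ c2\<close> is \<open>27 * x\<close>.\<close>
      then have "A * (27 * K) \<le> A * (22 * 3 ^ c2)" using K(3) by (intro mult_le_mono2) simp
      also have "\<dots> = 22 * (9 * (x * y))" using AN \<open>c1 = 0\<close> by simp
      finally have "27 * (K * A) \<le> 22 * (9 * (x * y))" by (simp add: mult_ac)
      then have "K * A \<le> 22 * x" unfolding y(1) by linarith
      moreover have "p + 1 \<le> k - 2" using 1 \<open>c1 = 0\<close> kr(1) by linarith
      ultimately show ?thesis using K(1) \<open>q = 0\<close> unfolding y by linarith
    qed
  next
    case 2
    then have "n = 3" using n by simp
    then obtain i j where ij: "c i \<notin> D" "c j \<notin> D" "A = f (c i) * f (c j)"
      "wtrees verts edges f = 4 * (f (c i) * f (c j)) + 2 * f (c i) + 2 * f (c j) + 1"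
      using wtrees_cycle3_one[of D f] f1 2 unfolding c2_def A_def by metis
    have y: "y = 2" using xy(2) kr 2 by auto
    \<comment> \<open>Both weights are at least 2, and the product of their excesses over 2 is
      nonnegative.\<close>
    have "2 * (f (c i) + f (c j)) \<le> A + 4"
    proof -
      obtain a b where "f (c i) = 2 + a" "f (c j) = 2 + b"
        using f2[of "c i"] f2[of "c j"] ij(1,2) by (auto simp: le_iff_add)
      then show ?thesis unfolding ij(3) by (simp add: algebra_simps)
    qed
    then have "wtrees verts edges f \<le> 5 * A + 5" unfolding ij(4) ij(3)[symmetric] by simp
    moreover have "A = 3 * x" using AN 2 y by simp
    ultimately have "wtrees verts edges f \<le> 8 * (x * y) + 5" using y by simp
    then show ?thesis using y kr 2 k(2) by simp
  next
    case 3
    then have "n = 4" using n by simp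
    then obtain i j where ij: "c i \<notin> D" "c j \<notin> D" "A = f (c i) * f (c j)"
      "wtrees verts edges f = 6 * (f (c i) * f (c j)) + 4 * f (c i) + 4 * f (c j) + 2"
      using wtrees_cycle4_two[of D f] f1 DD 3 unfolding c2_def A_def by metis
    have Axy: "A = x * y" using AN 3 by simp
    \<comment> \<open>Same cycle and same product as in the extremal graph, so only the sums of the
      weights are compared. The lower bound 3 is available when \<open>r = 0\<close>, since then
      \<open>q = 0\<close>.\<close>
    have "f (c i) + f (c j) \<le> x + y"
    proof (rule add_le_of_mult_eq)
      have "y \<le> f v" if "v \<in> verts - D" for v using f2[OF that] f3[OF _ that] xy(2) kr by auto
      then show "y \<le> f (c i)" "y \<le> f (c j)" using ij(1,2) by simp_all
      show "f (c i) * f (c j) = x * y" using Axy ij(3) by simp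
      show "0 < y" using xy(2) by auto
    qed
    then show ?thesis using ij(3,4) Axy kr 3 by simp
  qed
qed

text \<open>The extremal cycle is now the triangle with one segment of each length, so the factor is
  6 instead of 9. The terms \<open>4 * (x * 2) + 2 * x\<close> are \<open>5 * (x * 2)\<close>, which
  explains the ratio 5/6 demanded of \<open>K\<close>.\<close>

lemma cycle_bound_one:
  assumes f1: "\<And>v. v \<in> verts \<inter> D \<Longrightarrow> f v = 1" and f2: "\<And>v. v \<in> verts - D \<Longrightarrow> 2 \<le> f v"
    and DD: "\<And>e. e \<in> edges \<Longrightarrow> \<not> e \<subseteq> D"
    and k: "card (verts \<inter> D) + p = 1" and r: "r = card {e\<in>edges. e \<inter> D = {}} + q"
    and prod: "(\<Prod>v\<in>verts. f v) = 3 ^ p * 2 ^ q" and xy: "x * 2 = 2 ^ (r - 1)"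
  shows "wtrees verts edges f + (3 * p + q) \<le> 4 * (x * 2) + 2 * x + 2 * 2 + 1 + (r - 1)"
proof -
  define c1 where "c1 = card {e\<in>edges. e \<inter> D = {}}"
  define c2 where "c2 = card (verts \<inter> D)"
  define A where "A = (\<Prod>v\<in>verts. f v)"
  have n: "n = c1 + 2 * c2" using card_free_edges[OF DD] c1_def c2_def by simp
  have kr: "1 = c2 + p" "r = c1 + q" using k r by (simp_all add: c1_def c2_def)
  have c1: "1 \<le> c1" using n n3 kr(1) by linarith
  have AN: "A * (3 ^ c2 * 2 ^ c1) = 6 * (x * 2)"
  proof -
    have "A * (3 ^ c2 * 2 ^ c1) = 3 ^ (c2 + p) * 2 ^ r"
      unfolding A_def prod kr(2) by (simp add: power_add mult_ac)
    moreover have "(2::nat) ^ r = 2 ^ (1 + (r - 1))" using kr(2) c1 by simp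
    then have "(2::nat) ^ r = 2 * 2 ^ (r - 1)" unfolding power_add by simp
    ultimately show ?thesis using xy kr(1) by simp
  qed
  consider "3 \<le> c1 + c2" | "c1 = 1" "c2 = 1" using n n3 kr(1) by linarith
  then show ?thesis
  proof cases
    case 1
    have "c2 \<le> 1" using kr(1) by simp
    then obtain K where K: "wtrees verts edges f \<le> K * A" "6 * K \<le> 5 * (3 ^ c2 * 2 ^ c1)"
      using wtrees_cycle_factor[of D f c1 c2, OF f1 f2 DD c1_def c2_def 1] unfolding A_def by blast
    have "6 * (K * A) \<le> 5 * (A * (3 ^ c2 * 2 ^ c1))"
      using mult_le_mono2[OF K(2), of A] by (simp add: mult_ac)
    then have "K * A \<le> 5 * (x * 2)" unfolding AN by linarith
    then show ?thesis using K(1) kr c1 by simp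
  next
    case 2
    then have "n = 3" using n by simp
    then obtain i j where ij: "c i \<notin> D" "c j \<notin> D" "A = f (c i) * f (c j)"
      "wtrees verts edges f = 4 * (f (c i) * f (c j)) + 2 * f (c i) + 2 * f (c j) + 1"
      using wtrees_cycle3_one[of D f] f1 2 unfolding c2_def A_def by metis
    have Axy: "A = x * 2" using AN 2 by simp
    have "f (c i) + f (c j) \<le> x + 2"
      by (rule add_le_of_mult_eq) (use f2[of "c i"] f2[of "c j"] ij Axy in simp_all)
    then show ?thesis using ij(3,4) Axy kr 2 by simp
  qed
qed

lemma cycle_bound_zero:
  assumes f2: "\<And>v. v \<in> verts \<Longrightarrow> 2 \<le> f v"
    and prod: "(\<Prod>v\<in>verts. f v) = 2 ^ q" and m: "m = n + q" "6 \<le> m"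
  shows "wtrees verts edges f + q \<le> 17 * 2 ^ (m - 5) + m + 5"
proof -
  have "(2::nat) ^ m = 2 ^ (5 + (m - 5))" using m(2) by simp
  then have pm: "(2::nat) ^ m = 32 * 2 ^ (m - 5)" unfolding power_add by simp
  show ?thesis
  proof (cases "n = 3")
    case True
    have A: "(\<Prod>v\<in>verts. f v) = f (c 0) * f (c 1) * f (c 2)"
      unfolding prod_verts unfolding True by (simp add: numeral_eq_Suc)
    define x y z where "x = f (c 0)" and "y = f (c 1)" and "z = f (c 2)"
    obtain a b d where "x = 2 + a" "y = 2 + b" "z = 2 + d"
      using f2[of "c 0"] f2[of "c 1"] f2[of "c 2"] by (auto simp: le_iff_add x_def y_def z_def)
    \<comment> \<open>The difference is \<open>6 * (a * b + b * d + d * a) + 5 * a * b * d\<close>,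
      so there is equality whenever two weights are 2, as in the extremal graph.\<close>
    then have "4 * (x + y + z + x * y + y * z + z * x) \<le> 5 * (x * y * z) + 32"
      by (simp add: algebra_simps)
    moreover have xyz: "x * y * z = 2 ^ q" using A prod by (simp add: x_def y_def z_def)
    moreover have "8 * 2 ^ q = 32 * (2::nat) ^ (m - 5)" using pm m(1) True by (simp add: power_add)
    moreover have "wtrees verts edges f = (x + y + z + x * y + y * z + z * x) + 3 * (x * y * z)"
      using wtrees_cycle3[OF True, of f] by (simp add: x_def y_def z_def)
    moreover have "w \<le> 17 * T + 8" if "4 * S \<le> 5 * Q + 32" "8 * Q = 32 * T" "w = S + 3 * Q" for w S Q T :: nat
      using that by linarith
    ultimately have "wtrees verts edges f \<le> 17 * 2 ^ (m - 5) + 8" unfolding xyz by metis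
    then show ?thesis using m(1) True by linarith
  next
    case False
    then have n4: "4 \<le> n" using n3 by simp
    have "wtrees verts edges f \<le> 2 * n * 2 ^ q" using wtrees_cycle_le_double[of f] f2 prod by simp
    \<comment> \<open>Since \<open>m = n + q\<close>, the required
      \<open>2 * n * 2 ^ q \<le> 17 * 2 ^ (m - 5)\<close> is \<open>64 * n \<le> 17 * 2 ^ n\<close>
      after multiplication by 32 and cancellation of \<open>2 ^ q\<close>.\<close>
    moreover have "2 ^ q * (64 * n) \<le> 2 ^ q * (17 * (2::nat) ^ n)"
      by (rule mult_le_mono2[OF linear_le_power2_from4[OF n4]])
    then have "32 * (2 * n * 2 ^ q) \<le> 17 * (2::nat) ^ m" unfolding m(1) by (simp add: power_add mult_ac)
    then have "2 * n * 2 ^ q \<le> 17 * (2::nat) ^ (m - 5)" unfolding pm by simp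
    ultimately show ?thesis using m(1) by linarith
  qed
qed

section \<open>From a unicyclic graph to its weighted cycle\<close>

lemma degree_cycle: "degree edges (c t) = 2"
proof -
  have "{e\<in>edges. c t \<in> e} = {edge t, edge (t + (n - 1))}"
  proof
    show "{e\<in>edges. c t \<in> e} \<subseteq> {edge t, edge (t + (n - 1))}"
    proof
      fix e assume "e \<in> {e\<in>edges. c t \<in> e}"
      then obtain i where i: "e = edge i" "c t = c i \<or> c t = c (Suc i)" by (auto simp: edges_def edge_def)
      from i(2) show "e \<in> {edge t, edge (t + (n - 1))}"
      proof
        assume "c t = c i"
        then show ?thesis using i(1) by (simp add: edge_eq_iff c_eq_iff)
      next
        assume "c t = c (Suc i)"
        then have "(t + (n - 1)) mod n = (Suc i + (n - 1)) mod n"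
          by (metis c_eq_iff mod_add_left_eq)
        also have "\<dots> = i mod n" using n3 by simp
        finally show ?thesis using i(1) by (simp add: edge_eq_iff)
      qed
    qed
    have "c (Suc (t + (n - 1))) = c t" using n3 by (simp add: c_eq_iff)
    then have "c t \<in> edge t" "c t \<in> edge (t + (n - 1))" unfolding edge_def by simp_all
    then show "{edge t, edge (t + (n - 1))} \<subseteq> {e\<in>edges. c t \<in> e}" by simp
  qed
  moreover have "edge t \<noteq> edge (t + (n - 1))"
  proof
    assume "edge t = edge (t + (n - 1))"
    moreover have "t \<le> t + (n - 1)" "t + (n - 1) < t + n" using n3 by linarith+
    ultimately have "t = t + (n - 1)"
      using mod_eq_in_window[of t t "t + (n - 1)"] n3 unfolding edge_eq_iff by linarith
    then show False using n3 by linarith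
  qed
  ultimately show ?thesis by (simp add: degree_def)
qed

lemma connected_cycle: "connected_graph verts edges"
proof -
  have "c ` {0..<0 + n} = verts" by (rule verts_window)
  moreover have "is_tree (c ` {0..<0 + n}) (edge ` {0..<0 + n - 1})" using n3 by (intro is_tree_arc) auto
  ultimately have "connected_graph verts (edge ` {0..<0 + n - 1})" by (simp add: is_tree_def)
  moreover have "edge ` {0..<0 + n - 1} \<subseteq> edges" by auto
  ultimately show ?thesis
    unfolding connected_graph_def by (simp add: rtranclp_adj_mono)
qed

lemma Union_edges: "\<Union>edges = verts"
proof
  show "\<Union>edges \<subseteq> verts" using simple_graphD(3)[OF simple_graph_cycle] by blast
  show "verts \<subseteq> \<Union>edges"
  proof
    fix x assume "x \<in> verts"
    then obtain i where "x = c i" by (auto simp: verts_def)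
    then have "x \<in> edge i" by (simp add: edge_def)
    then show "x \<in> \<Union>edges" using edge_in_edges by blast
  qed
qed

end

text \<open>Collects what peeling leaves behind. The comparison with the extremal value uses only
  the weighted cycle and the numbers \<open>p\<close> and \<open>q\<close> of attachments.\<close>

lemma unicyclic_short_segments_bound:
  fixes V :: "'a set"
  assumes uni: "unicyclic V E" and seq: "segment_sequence V E = mset l"
    and l: "l \<noteq> []" "\<And>x. x \<in> set l \<Longrightarrow> x \<le> 2"
  obtains c :: "nat \<Rightarrow> 'a" and n f D p q where
    "cycle_walk c n"
    "\<And>v. v \<in> cycle_walk.verts c n \<inter> D \<Longrightarrow> f v = 1"
    "\<And>v. v \<in> cycle_walk.verts c n - D \<Longrightarrow> 2 \<le> f v"
    "\<And>v. q = 0 \<Longrightarrow> v \<in> cycle_walk.verts c n - D \<Longrightarrow> 3 \<le> f v"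
    "\<And>e. e \<in> cycle_walk.edges c n \<Longrightarrow> \<not> e \<subseteq> D"
    "count (mset l) 2 = card (cycle_walk.verts c n \<inter> D) + p"
    "count (mset l) 1 = card {e \<in> cycle_walk.edges c n. e \<inter> D = {}} + q"
    "(\<Prod>v\<in>cycle_walk.verts c n. f v) = 3 ^ p * 2 ^ q"
    "num_subtrees V E \<le> wtrees (cycle_walk.verts c n) (cycle_walk.edges c n) f + (3 * p + q) + 1"
proof -
  have G: "simple_graph V E" and conn: "connected_graph V E" and c1: "card (cycles E) = 1"
    using uni by (auto simp: unicyclic_def)
  obtain C where C: "cycles E = {C}" using c1 by (auto simp: card_1_singleton_iff)
  then have CE: "C \<subseteq> E" "is_cycle C" by (auto simp: cycles_def)
  obtain c n where walk: "cycle_walk c n" and C_edges: "C = cycle_walk.edges c n"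
    using is_cycle_obtain_walk[OF CE(2)] .
  interpret cycle_walk c n by (rule walk)
  define D where "D = {v\<in>V. degree E v = 2}"
  note counts = short_segments_counts[OF G conn D_def seq l]
  have sub: "verts \<subseteq> V"
  proof -
    have "e \<subseteq> V" if "e \<in> edges" for e using simple_graphD(3)[OF G, of e] that CE(1) C_edges by auto
    then show ?thesis unfolding Union_edges[symmetric] by blast
  qed
  obtain p q where gr: "grown D verts C p q V E"
    using unicyclic_grown[OF G conn C, of D verts] counts(1) simple_graph_cycle connected_cycle sub
      Union_edges C_edges by (auto simp: D_def)
  have W: "simple_graph verts C" using simple_graph_cycle C_edges by simp
  obtain f where f: "\<forall>x. 1 \<le> f x" "\<forall>x\<in>D. f x = 1"
    "wtrees V E (\<lambda>_. 1) \<le> wtrees verts C f + (3 * p + q)"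
    "(\<Prod>x\<in>verts. f x) = 3 ^ p * 2 ^ q * (\<Prod>x\<in>V. 1)"
    "\<forall>x\<in>verts - D. (\<exists>e\<in>E - C. x \<in> e) \<longrightarrow> 2 * 1 \<le> f x \<and> (q = 0 \<longrightarrow> 3 * 1 \<le> f x)"
    using grown_wtrees_le[OF gr W, of "\<lambda>_. 1"] by auto
  \<comment> \<open>A cycle vertex with no further edge would have degree 2 and lie in
    \<open>D\<close>; so the lower bounds 2 and 3 apply to every cycle vertex outside
    \<open>D\<close>.\<close>
  have branch: "\<exists>e\<in>E - C. v \<in> e" if v: "v \<in> verts - D" for v
  proof (rule ccontr)
    assume no: "\<not> (\<exists>e\<in>E - C. v \<in> e)"
    then have "{e\<in>E. v \<in> e} = {e\<in>C. v \<in> e}" using CE(1) by blast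
    moreover obtain t where "v = c t" using v by (auto simp: verts_def)
    ultimately have "degree E v = 2" using degree_cycle[of t] C_edges by (simp add: degree_def)
    then show False using v sub by (auto simp: D_def)
  qed
  have card: "card (V \<inter> D) = card (verts \<inter> D) + p"
    "card {e\<in>E. e \<inter> D = {}} = card {e\<in>C. e \<inter> D = {}} + q"
    using grown_counts[OF gr W] by auto
  have VD: "V \<inter> D = D" by (auto simp: D_def)
  show ?thesis
  proof (rule that[OF walk, of D f q p])
    show "\<And>v. v \<in> verts \<inter> D \<Longrightarrow> f v = 1" using f(2) by auto
    show "\<And>v. v \<in> verts - D \<Longrightarrow> 2 \<le> f v" using f(5) branch by auto
    show "\<And>v. q = 0 \<Longrightarrow> v \<in> verts - D \<Longrightarrow> 3 \<le> f v" using f(5) branch by auto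
    show "\<And>e. e \<in> edges \<Longrightarrow> \<not> e \<subseteq> D" using counts(1) CE(1) C_edges by auto
    show "count (mset l) 2 = card (verts \<inter> D) + p" using counts(3) card(1) VD by simp
    show "count (mset l) 1 = card {e \<in> edges. e \<inter> D = {}} + q" using counts(4) card(2) C_edges by simp
    show "(\<Prod>v\<in>verts. f v) = 3 ^ p * 2 ^ q" using f(4) by simp
    show "num_subtrees V E \<le> wtrees verts edges f + (3 * p + q) + 1"
      using f(3) C_edges by (simp add: num_subtrees_eq_wtrees)
  qed
qed

lemma sorted_le2_replicate:
  fixes l :: "nat list"
  assumes "sorted_wrt (\<ge>) l" "set l \<subseteq> {1, 2}"
  shows "l = replicate (count (mset l) 2) 2 @ replicate (count (mset l) 1) 1"
  using assms
proof (induction l)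
  case (Cons x xs)
  then have xs: "xs = replicate (count (mset xs) 2) 2 @ replicate (count (mset xs) 1) 1" by auto
  show ?case
  proof (cases "x = 2")
    case True
    then show ?thesis using xs by simp
  next
    case False
    then have x: "x = 1" using Cons.prems by auto
    then have "\<forall>y\<in>set xs. y = 1" using Cons.prems by fastforce
    then have z: "count (mset xs) 2 = 0" by (auto simp: count_eq_zero_iff)
    have "xs = replicate (count (mset xs) 1) 1" using xs unfolding z replicate_0 append_Nil .
    then have e: "x # xs = replicate (Suc (count (mset xs) 1)) 1" using x by (metis replicate_Suc)
    have "count (mset (x # xs)) 2 = 0" "count (mset (x # xs)) 1 = Suc (count (mset xs) 1)"
      using z x by simp_all
    then show ?thesis unfolding e[symmetric] by (metis append_Nil e replicate_0)
  qed
qed simp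

subsection \<open>The extremal graphs\<close>

lemma cycle_walk_Cyc: "3 \<le> n \<Longrightarrow> cycle_walk (\<lambda>i. Cyc (i mod n)) n"
  by unfold_locales auto

lemma cycle_walk_nat: "3 \<le> n \<Longrightarrow> cycle_walk (\<lambda>i. i mod n :: nat) n"
  by unfold_locales auto

lemma Uab_Nil:
  assumes "3 \<le> a + b"
  shows "Uab_V a b [] [] = cycle_walk.verts (\<lambda>i. Cyc (i mod (a + b))) (a + b)"
    "Uab_E a b [] [] = cycle_walk.edges (\<lambda>i. Cyc (i mod (a + b))) (a + b)"
proof -
  interpret cycle_walk "\<lambda>i. Cyc (i mod (a + b))" "a + b" by (rule cycle_walk_Cyc[OF assms])
  show "Uab_V a b [] [] = verts" by (auto simp: Uab_V_def verts_def)
  show "Uab_E a b [] [] = edges" by (auto simp: Uab_E_def edges_def edge_def)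
qed

lemma Collect_nth_snoc:
  "{g j | j. j < length (xs @ [s]) \<and> Q ((xs @ [s]) ! j)}
    = {g j | j. j < length xs \<and> Q (xs ! j)} \<union> (if Q s then {g (length xs)} else {})"
proof (intro set_eqI iffI)
  fix e assume "e \<in> {g j | j. j < length (xs @ [s]) \<and> Q ((xs @ [s]) ! j)}"
  then obtain j where j: "e = g j" "j < Suc (length xs)" "Q ((xs @ [s]) ! j)" by auto
  then consider "j < length xs" "Q (xs ! j)" | "j = length xs" "Q s" by (auto simp: nth_append less_Suc_eq)
  then show "e \<in> {g j | j. j < length xs \<and> Q (xs ! j)} \<union> (if Q s then {g (length xs)} else {})"
    using j(1) by cases auto
next
  fix e assume "e \<in> {g j | j. j < length xs \<and> Q (xs ! j)} \<union> (if Q s then {g (length xs)} else {})"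
  then consider j where "e = g j" "j < length xs" "Q (xs ! j)" | "e = g (length xs)" "Q s"
    by (auto split: if_splits)
  then show "e \<in> {g j | j. j < length (xs @ [s]) \<and> Q ((xs @ [s]) ! j)}"
  proof cases
    case 1
    then show ?thesis by (intro CollectI exI[of _ j]) (simp add: nth_append)
  next
    case 2
    then show ?thesis by (intro CollectI exI[of _ "length xs"]) simp
  qed
qed

lemma Collect_nth_snoc2:
  "{g j k | j k. j < length (xs @ [s]) \<and> Q k ((xs @ [s]) ! j)}
    = {g j k | j k. j < length xs \<and> Q k (xs ! j)} \<union> g (length xs) ` {k. Q k s}"
proof -
  have U: "{g j k | j k. j < length ys \<and> Q k (ys ! j)} = (\<Union>k. {g j k | j. j < length ys \<and> Q k (ys ! j)})" for ys
    by blast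
  have "(\<Union>k. if Q k s then {g (length xs) k} else {}) = g (length xs) ` {k. Q k s}"
    by (auto split: if_splits)
  then show ?thesis unfolding U Collect_nth_snoc[where Q="Q _"] UN_Un_distrib by simp
qed

lemma one_two_intervals:
  "{k. 1 \<le> k \<and> k \<le> (1::nat)} = {1}" "{k. 1 \<le> k \<and> k < (1::nat)} = {}"
  "{k. 1 \<le> k \<and> k \<le> (2::nat)} = {1, 2}" "{k. 1 \<le> k \<and> k < (2::nat)} = {1}"
  by auto

text \<open>Appending at the end keeps the indices of the other pendent paths, so the new graph is
  literally the old one with a path attached.\<close>

lemma Uab_snoc_ss:
  "Uab_V a b (ss @ [s]) rs = Uab_V a b ss rs \<union> PX (length ss) ` {k. 1 \<le> k \<and> k \<le> s}"
  "Uab_E a b (ss @ [s]) rs = Uab_E a b ss rs \<union> (if 1 \<le> s then {{Cyc 0, PX (length ss) 1}} else {})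
    \<union> (\<lambda>k. {PX (length ss) k, PX (length ss) (k + 1)}) ` {k. 1 \<le> k \<and> k < s}"
  unfolding Uab_V_def Uab_E_def
    Collect_nth_snoc2[where Q="\<lambda>k v. 1 \<le> k \<and> k \<le> v" and g=PX]
    Collect_nth_snoc2[where Q="\<lambda>k v. 1 \<le> k \<and> k < v" and g="\<lambda>j k. {PX j k, PX j (k + 1)}"]
    Collect_nth_snoc[where Q="\<lambda>v. 1 \<le> v" and g="\<lambda>j. {Cyc 0, PX j 1}"]
  by (simp_all only: Un_ac)

lemma Uab_snoc_rs:
  "Uab_V a b ss (rs @ [s]) = Uab_V a b ss rs \<union> PY (length rs) ` {k. 1 \<le> k \<and> k \<le> s}"
  "Uab_E a b ss (rs @ [s]) = Uab_E a b ss rs \<union> (if 1 \<le> s then {{Cyc a, PY (length rs) 1}} else {})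
    \<union> (\<lambda>k. {PY (length rs) k, PY (length rs) (k + 1)}) ` {k. 1 \<le> k \<and> k < s}"
  unfolding Uab_V_def Uab_E_def
    Collect_nth_snoc2[where Q="\<lambda>k v. 1 \<le> k \<and> k \<le> v" and g=PY]
    Collect_nth_snoc2[where Q="\<lambda>k v. 1 \<le> k \<and> k < v" and g="\<lambda>j k. {PY j k, PY j (k + 1)}"]
    Collect_nth_snoc[where Q="\<lambda>v. 1 \<le> v" and g="\<lambda>j. {Cyc a, PY j 1}"]
  by (simp_all only: Un_ac)

lemma Uab_snoc1:
  "Uab_V a b (ss @ [1]) rs = insert (PX (length ss) 1) (Uab_V a b ss rs)"
  "Uab_E a b (ss @ [1]) rs = insert {Cyc 0, PX (length ss) 1} (Uab_E a b ss rs)"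
  unfolding Uab_snoc_ss one_two_intervals by simp_all

lemma Uab_snoc2:
  "Uab_V a b (ss @ [2]) rs = insert (PX (length ss) 2) (insert (PX (length ss) 1) (Uab_V a b ss rs))"
  "Uab_E a b (ss @ [2]) rs = insert {PX (length ss) 1, PX (length ss) 2}
    (insert {Cyc 0, PX (length ss) 1} (Uab_E a b ss rs))"
  unfolding Uab_snoc_ss one_two_intervals by (simp_all add: insert_commute numeral_2_eq_2)

lemma Uab_PY1:
  "Uab_V a b [] [1] = insert (PY 0 1) (Uab_V a b [] [])"
  "Uab_E a b [] [1] = insert {Cyc a, PY 0 1} (Uab_E a b [] [])"
  using Uab_snoc_rs[of a b "[]" "[]" 1] unfolding one_two_intervals by simp_all

lemma Uab_PY2:
  "Uab_V a b [] [2] = insert (PY 0 2) (insert (PY 0 1) (Uab_V a b [] []))"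
  "Uab_E a b [] [2] = insert {PY 0 1, PY 0 2} (insert {Cyc a, PY 0 1} (Uab_E a b [] []))"
  using Uab_snoc_rs[of a b "[]" "[]" 2] unfolding one_two_intervals
  by (simp_all add: insert_commute numeral_2_eq_2)

section \<open>Exact counts for the extremal graphs by peeling\<close>

definition cyc_weight :: "nat \<Rightarrow> nat \<Rightarrow> nat \<Rightarrow> uvert \<Rightarrow> nat" where
  "cyc_weight a x y = (\<lambda>v. 1)(Cyc 0 := x, Cyc a := y)"

lemma cyc_weight_simps:
  "0 < a \<Longrightarrow> cyc_weight a x y (Cyc 0) = x" "cyc_weight a x y (Cyc a) = y"
  "cyc_weight a x y (PX i j) = 1" "cyc_weight a x y (PY i j) = 1"
  "(cyc_weight a x y)(Cyc a := z) = cyc_weight a x z"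
  "0 < a \<Longrightarrow> (cyc_weight a x y)(Cyc 0 := z) = cyc_weight a z y"
  by (auto simp: cyc_weight_def)

lemma Uab_notin:
  "PX (length ss) k \<notin> Uab_V a b ss rs" "PY j k \<notin> Uab_V a b [] []"
  by (auto simp: Uab_V_def)

lemma Cyc_in_Uab: "i < a + b \<Longrightarrow> Cyc i \<in> Uab_V a b ss rs"
  by (simp add: Uab_V_def)

text \<open>The terms \<open>y + 1\<close> and \<open>2 * y - 1\<close> describe both attachments at
  once: factor 2 and summand 1 for a pendent vertex, factor 3 and summand 3 for a pendent path of
  length 2.\<close>

lemma wtrees_Uab_Nil:
  assumes "3 \<le> a + b" "0 < a" "0 < b" "y = 1 \<or> y = 2"
  shows "simple_graph (Uab_V a b [] [y]) (Uab_E a b [] [y]) \<and>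
    wtrees (Uab_V a b [] [y]) (Uab_E a b [] [y]) (cyc_weight a c d)
    = wtrees (Uab_V a b [] []) (Uab_E a b [] []) (cyc_weight a c (d * (y + 1))) + (2 * y - 1)"
proof -
  have G: "simple_graph (Uab_V a b [] []) (Uab_E a b [] [])"
    unfolding Uab_Nil[OF assms(1)] by (rule cycle_walk.simple_graph_cycle[OF cycle_walk_Cyc[OF assms(1)]])
  have ca: "Cyc a \<in> Uab_V a b [] []" using assms by (intro Cyc_in_Uab) simp
  have G1: "simple_graph (Uab_V a b [] [1]) (Uab_E a b [] [1])"
    unfolding Uab_PY1 by (rule simple_graph_add_leaf[OF G ca Uab_notin(2)])
  from assms(4) show ?thesis
  proof
    assume y: "y = 1"
    show ?thesis
      using G1 wtrees_add_leaf[OF G ca Uab_notin(2)[of 0 1], of "cyc_weight a c d"]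
      unfolding y Uab_PY1 by (simp add: cyc_weight_simps mult.commute)
  next
    assume y: "y = 2"
    have ni: "PY 0 2 \<notin> insert (PY 0 1) (Uab_V a b [] [])" using Uab_notin(2) by simp
    have "simple_graph (Uab_V a b [] [2]) (Uab_E a b [] [2])"
      unfolding Uab_PY2 using simple_graph_add_leaf[OF G1[unfolded Uab_PY1] insertI1 ni] .
    then show ?thesis
      using wtrees_add_path[OF G ca Uab_notin(2)[of 0 1] ni, of "cyc_weight a c d"]
      unfolding y Uab_PY2 by (simp add: cyc_weight_simps mult.commute)
  qed
qed

lemma wtrees_Uab:
  assumes "3 \<le> a + b" "0 < a" "0 < b" "y = 1 \<or> y = 2" "set ss \<subseteq> {1, 2}"
  shows "simple_graph (Uab_V a b ss [y]) (Uab_E a b ss [y]) \<and>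
    wtrees (Uab_V a b ss [y]) (Uab_E a b ss [y]) (cyc_weight a c 1)
    = wtrees (Uab_V a b [] []) (Uab_E a b [] []) (cyc_weight a (c * (\<Prod>s\<leftarrow>ss. s + 1)) (y + 1))
      + (\<Sum>s\<leftarrow>ss. 2 * s - 1) + (2 * y - 1)"
  using assms(5)
\<comment> \<open>The last path is peeled before the induction hypothesis is applied, so the weight
  \<open>c\<close> at \<open>Cyc 0\<close> has to vary.\<close>
proof (induction ss arbitrary: c rule: rev_induct)
  case Nil
  then show ?case using wtrees_Uab_Nil[OF assms(1-4), of c 1] by simp
next
  case (snoc s ss)
  let ?V = "Uab_V a b ss [y]" and ?E = "Uab_E a b ss [y]"
  have G: "simple_graph ?V ?E" using snoc by simp
  have IH: "wtrees ?V ?E (cyc_weight a c 1)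
    = wtrees (Uab_V a b [] []) (Uab_E a b [] []) (cyc_weight a (c * (\<Prod>s\<leftarrow>ss. s + 1)) (y + 1))
      + (\<Sum>s\<leftarrow>ss. 2 * s - 1) + (2 * y - 1)" for c using snoc by simp
  have c0: "Cyc 0 \<in> ?V" using assms by (intro Cyc_in_Uab) simp
  have ni1: "PX (length ss) 1 \<notin> ?V" by (rule Uab_notin)
  have ni: "PX (length ss) 2 \<notin> insert (PX (length ss) 1) ?V" using Uab_notin(1) by simp
  have G1: "simple_graph (insert (PX (length ss) 1) ?V) (insert {Cyc 0, PX (length ss) 1} ?E)"
    by (rule simple_graph_add_leaf[OF G c0 ni1])
  have "s = 1 \<or> s = 2" using snoc.prems by auto
  then show ?case
  proof
    assume s: "s = 1"
    show ?thesis
      using G1 wtrees_add_leaf[OF G c0 ni1, of "cyc_weight a c 1"] IH[of "c + c"]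
      unfolding s Uab_snoc1 by (simp add: cyc_weight_simps assms algebra_simps)
  next
    assume s: "s = 2"
    have "simple_graph (insert (PX (length ss) 2) (insert (PX (length ss) 1) ?V))
      (insert {PX (length ss) 1, PX (length ss) 2} (insert {Cyc 0, PX (length ss) 1} ?E))"
      by (rule simple_graph_add_leaf[OF G1 insertI1 ni])
    then show ?thesis
      using wtrees_add_path[OF G c0 ni1 ni, of "cyc_weight a c 1"] IH[of "c * 3"]
      unfolding s Uab_snoc2 by (simp add: cyc_weight_simps assms mult_ac)
  qed
qed

lemma num_subtrees_Uab:
  assumes "a = 2" "b = 1 \<or> b = 2" "y = 1 \<or> y = 2" "set ss \<subseteq> {1, 2}"
  shows "num_subtrees (Uab_V a b ss [y]) (Uab_E a b ss [y])
    = wtrees (Uab_V a b [] []) (Uab_E a b [] []) (cyc_weight a (\<Prod>s\<leftarrow>ss. s + 1) (y + 1))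
      + (\<Sum>s\<leftarrow>ss. 2 * s - 1) + (2 * y - 1) + 1"
proof -
  have "cyc_weight a 1 1 = (\<lambda>_. 1)" by (auto simp: cyc_weight_def)
  then show ?thesis unfolding num_subtrees_eq_wtrees
    using wtrees_Uab[of a b y ss 1] assms by auto
qed

lemma wtrees_Uab_21:
  "wtrees (Uab_V 2 1 [] []) (Uab_E 2 1 [] []) (cyc_weight 2 x y) = 4 * (x * y) + 2 * x + 2 * y + 1"
proof -
  interpret cycle_walk "\<lambda>i. Cyc (i mod (2 + 1))" "2 + 1" by (rule cycle_walk_Cyc) simp
  have eq: "Uab_V 2 1 [] [] = verts" "Uab_E 2 1 [] [] = edges" using Uab_Nil[of 2 1] by simp_all
  show ?thesis unfolding eq
    using wtrees_cycle3[of "cyc_weight 2 x y"] by (simp add: cyc_weight_def)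
qed

lemma wtrees_Uab_22:
  "wtrees (Uab_V 2 2 [] []) (Uab_E 2 2 [] []) (cyc_weight 2 x y) = 6 * (x * y) + 4 * x + 4 * y + 2"
proof -
  interpret cycle_walk "\<lambda>i. Cyc (i mod (2 + 2))" "2 + 2" by (rule cycle_walk_Cyc) simp
  have eq: "Uab_V 2 2 [] [] = verts" "Uab_E 2 2 [] [] = edges" using Uab_Nil[of 2 2] by simp_all
  show ?thesis unfolding eq
    using wtrees_cycle4[of "cyc_weight 2 x y"] by (simp add: cyc_weight_def cyc4_def)
qed

text \<open>A triangle with weights \<open>c\<close>, 2, 2 has weighted count
  \<open>17 * c + 8\<close>. The two single pendent vertices add 2, and each pendent vertex at 0
  doubles \<open>c\<close> and adds 1.\<close>

lemma num_subtrees_U1: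
  assumes "5 \<le> m"
  shows "num_subtrees (U1_V m) (U1_E m) = 17 * 2 ^ (m - 5) + m + 6"
proof -
  interpret cycle_walk "\<lambda>i. i mod 3 :: nat" 3 by (rule cycle_walk_nat) simp
  have "{..<3} = {0, 1, 2::nat}" by auto
  then have triangle: "verts = {0, 1, 2}" "edges = {{0, 1}, {1, 2}, {0, 2}}"
    by (simp_all add: verts_def edges_def edge_def insert_commute numeral_2_eq_2)
  have U1_E': "U1_E n = {{0,1},{1,2},{0,2},{1,3},{2,4}} \<union> (\<lambda>j. {0, j}) ` {5..<n}" for n
  proof -
    have "{{0, j} | j. 5 \<le> j \<and> j < n} = (\<lambda>j. {0, j}) ` {5..<n}" by (auto simp: image_iff)
    then show ?thesis by (simp add: U1_E_def)
  qed
  define f :: "nat \<Rightarrow> nat \<Rightarrow> nat" where "f c = (\<lambda>v. 1)(0 := c)" for c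
  have step: "simple_graph (U1_V m) (U1_E m) \<and> wtrees (U1_V m) (U1_E m) (f c) = 17 * c * 2 ^ (m - 5) + m + 5" for c
    using assms
  proof (induction m arbitrary: c rule: dec_induct)
    case base
    have T: "simple_graph {0, 1, 2} {{0, 1}, {1, 2}, {0, 2::nat}}"
      using simple_graph_cycle unfolding triangle .
    have V: "U1_V 5 = insert 4 (insert 3 {0, 1, 2})" by (auto simp: U1_V_def)
    have E: "U1_E 5 = insert {2, 4} (insert {1, 3} {{0, 1}, {1, 2}, {0, 2}})" by (simp add: U1_E' insert_commute)
    have T1: "simple_graph (insert 3 {0, 1, 2}) (insert {1, 3} {{0, 1}, {1, 2}, {0, 2::nat}})"
      by (rule simple_graph_add_leaf[OF T]) simp_all
    have T2: "simple_graph (U1_V 5) (U1_E 5)"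
      unfolding V E by (rule simple_graph_add_leaf[OF T1]) simp_all
    have "(f c)(2 := f c 2 * (1 + f c 4)) = (f c)(2 := 2)" "f c 4 = 1" by (simp_all add: f_def fun_eq_iff)
    then have "wtrees (U1_V 5) (U1_E 5) (f c)
      = wtrees (insert 3 {0, 1, 2}) (insert {1, 3} {{0, 1}, {1, 2}, {0, 2}}) ((f c)(2 := 2)) + 1"
      using wtrees_add_leaf[OF T1, of 2 4 "f c"] unfolding V E by simp
    moreover define g where "g = (f c)(2 := 2)"
    have "g(1 := g 1 * (1 + g 3)) = g(1 := 2)" "g 3 = 1" by (simp_all add: g_def f_def fun_eq_iff)
    then have "wtrees (insert 3 {0, 1, 2}) (insert {1, 3} {{0, 1}, {1, 2}, {0, 2}}) g
      = wtrees {0, 1, 2} {{0, 1}, {1, 2}, {0, 2}} (g(1 := 2)) + 1"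
      using wtrees_add_leaf[OF T, of 1 3 g] by simp
    moreover have "wtrees {0, 1, 2} {{0, 1}, {1, 2}, {0, 2}} (g(1 := 2)) = 17 * c + 8"
      unfolding triangle[symmetric] wtrees_cycle3[OF refl] by (simp add: g_def f_def)
    ultimately have "wtrees (U1_V 5) (U1_E 5) (f c) = 17 * c + 10" unfolding g_def by simp
    then show ?case using T2 by simp
  next
    case (step m)
    have V: "U1_V (Suc m) = insert m (U1_V m)" by (auto simp: U1_V_def)
    have E: "U1_E (Suc m) = insert {0, m} (U1_E m)" using step.hyps by (simp add: U1_E' atLeastLessThanSuc)
    have "0 \<in> U1_V m" "m \<notin> U1_V m" using step.hyps by (auto simp: U1_V_def)
    note leaf = simple_graph_add_leaf[OF _ this] wtrees_add_leaf[OF _ this, of _ "f c"]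
    have "(f c)(0 := f c 0 * (1 + f c m)) = f (2 * c)" "f c m = 1" using step.hyps by (auto simp: f_def)
    moreover have "Suc m - 5 = Suc (m - 5)" using step.hyps by linarith
    then have "(2::nat) ^ (Suc m - 5) = 2 * 2 ^ (m - 5)" by simp
    ultimately show ?case unfolding V E using leaf step.IH[of c] step.IH[of "2 * c"] by simp
  qed
  have "f 1 = (\<lambda>_. 1)" by (auto simp: f_def)
  then show ?thesis using step[of 1] by (simp add: num_subtrees_eq_wtrees)
qed

theorem theorem4:
  fixes l :: "nat list" and V :: "'a set" and E :: "'a set set"
  assumes nonincr: "sorted_wrt (\<ge>) l"
    and l1: "l ! 0 \<le> 2"
    and H: "(V, E) \<in> U_seq l"
  shows "(l ! 0 = 2 \<and> length l \<ge> 4 \<longrightarrow>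
            num_subtrees V E \<le>
            num_subtrees (Uab_V (l ! 0) (l ! 1) (take (length l - 3) (drop 2 l)) [l ! (length l - 1)])
                         (Uab_E (l ! 0) (l ! 1) (take (length l - 3) (drop 2 l)) [l ! (length l - 1)]))
       \<and> (l ! 0 = 1 \<and> length l \<ge> 6 \<longrightarrow>
            num_subtrees V E \<le> num_subtrees (U1_V (length l)) (U1_E (length l)))"
proof (cases "4 \<le> length l")
  case False
  then show ?thesis by simp
next
  case True
  then have ne: "l \<noteq> []" by auto
  have uni: "unicyclic V E" and seq: "segment_sequence V E = mset l" using H by (auto simp: U_seq_def)
  have le2: "x \<le> 2" if x: "x \<in> set l" for x
  proof -
    obtain i where "i < length l" "x = l ! i" using x by (metis in_set_conv_nth)
    then show ?thesis using sorted_wrt_nth_less[OF nonincr, of 0 i] l1 by (cases i) auto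
  qed
  have G: "simple_graph V E" "connected_graph V E" using uni by (auto simp: unicyclic_def)
  have set: "set l \<subseteq> {1, 2}" using short_segments_counts(2)[OF G refl seq ne le2] .
  define k where "k = count (mset l) 2"
  define r where "r = count (mset l) 1"
  have l: "l = replicate k 2 @ replicate r 1"
    using sorted_le2_replicate[OF nonincr set] by (simp add: k_def r_def)
  have m: "length l = k + r" using arg_cong[OF l, of length] by simp
  obtain c :: "nat \<Rightarrow> 'a" and n D f q p where walk: "cycle_walk c n"
    and f1: "\<And>v. v \<in> cycle_walk.verts c n \<inter> D \<Longrightarrow> f v = 1"
    and f2: "\<And>v. v \<in> cycle_walk.verts c n - D \<Longrightarrow> 2 \<le> f v"
    and f3: "\<And>v. q = 0 \<Longrightarrow> v \<in> cycle_walk.verts c n - D \<Longrightarrow> 3 \<le> f v"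
    and DD: "\<And>e. e \<in> cycle_walk.edges c n \<Longrightarrow> \<not> e \<subseteq> D"
    and k: "k = card (cycle_walk.verts c n \<inter> D) + p"
    and r: "r = card {e \<in> cycle_walk.edges c n. e \<inter> D = {}} + q"
    and prod: "(\<Prod>v\<in>cycle_walk.verts c n. f v) = 3 ^ p * 2 ^ q"
    and bound: "num_subtrees V E \<le> wtrees (cycle_walk.verts c n) (cycle_walk.edges c n) f + (3 * p + q) + 1"
    by (rule unicyclic_short_segments_bound[OF uni seq ne, folded k_def r_def], erule le2) (rule that)
  interpret cycle_walk c n by (rule walk)
  have nth: "l ! i = (if i < k then 2 else 1)" if "i < length l" for i
    using that unfolding m by (subst l) (auto simp: nth_append)
  have pos: "0 < length l" "1 < length l" "length l - 1 < length l" using True by linarith+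
  note nths = nth[OF pos(1)] nth[OF pos(2)] nth[OF pos(3)]
  define ss where "ss = take (length l - 3) (drop 2 l)"
  show ?thesis
  proof (intro conjI impI)
    assume h: "l ! 0 = 2 \<and> 4 \<le> length l"
    then have k1: "1 \<le> k" using nths(1) by (auto split: if_splits)
    have ss_set: "set ss \<subseteq> {1, 2}" using set by (auto simp: ss_def dest!: in_set_takeD in_set_dropD)
    show "num_subtrees V E \<le> num_subtrees
        (Uab_V (l ! 0) (l ! 1) (take (length l - 3) (drop 2 l)) [l ! (length l - 1)])
        (Uab_E (l ! 0) (l ! 1) (take (length l - 3) (drop 2 l)) [l ! (length l - 1)])"
    proof (cases "k = 1")
      case k: True
      have ll: "l ! 0 = 2" "l ! 1 = 1" "l ! (length l - 1) = 1" using nths m k True by (simp_all split: if_splits)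
      \<comment> \<open>Dropping two entries removes the only 2 and one 1; the last of the remaining
        ones is the path at the other attachment vertex.\<close>
      have ss: "ss = replicate (r - 2) 1" unfolding ss_def m k by (subst l) (simp add: k)
      define x where "x = (2::nat) ^ (r - 2)"
      have "r - 1 = Suc (r - 2)" using m k True by simp
      then have x: "x * 2 = 2 ^ (r - 1)" by (simp add: x_def)
      have "wtrees verts edges f + (3 * p + q) \<le> 4 * (x * 2) + 2 * x + 2 * 2 + 1 + (r - 1)"
        by (rule cycle_bound_one[OF f1 f2 DD _ r prod x]) (use \<open>k = card (verts \<inter> D) + p\<close> k in simp_all)
      then have "num_subtrees V E \<le> 4 * (x * 2) + 2 * x + 2 * 2 + 1 + (r - 2) + 1 + 1"
        using bound \<open>r - 1 = Suc (r - 2)\<close> by simp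
      also have "\<dots> = num_subtrees (Uab_V 2 1 ss [1]) (Uab_E 2 1 ss [1])"
        using num_subtrees_Uab[of 2 1 1 ss] ss_set wtrees_Uab_21[of x 2]
        by (simp add: ss x_def numeral_2_eq_2[symmetric] sum_list_replicate)
      finally show ?thesis using ll by (simp add: ss_def)
    next
      case False
      then have k2: "2 \<le> k" using k1 by simp
      define z where "z = l ! (length l - 1)"
      have ll: "l ! 0 = 2" "l ! 1 = 2" using nths(1,2) k2 by simp_all
      \<comment> \<open>The last entry is a smallest one, so it is 2 exactly when there are no
        segments of length 1; this is the alternative for \<open>y = z + 1\<close> in
        \<open>cycle_bound_two\<close>.\<close>
      have z: "z = (if r = 0 then 2 else 1)" using nths(3) m True by (auto simp: z_def)
      have drop2: "drop 2 l = replicate (k - 2) 2 @ replicate r 1" using k2 by (subst l) simp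
      have "drop 2 l = ss @ [z]"
      proof -
        have len: "length (drop 2 l) = Suc (length l - 3)" using True by simp
        have "2 + (length l - 3) = length l - 1" "2 \<le> length l" using True by linarith+
        then have "drop 2 l ! (length l - 3) = z" by (simp only: nth_drop z_def)
        then show ?thesis using take_Suc_conv_app_nth[of "length l - 3" "drop 2 l"] len by (simp add: ss_def)
      qed
      then have ssz: "ss @ [z] = replicate (k - 2) 2 @ replicate r 1" using drop2 by simp
      define x where "x = (\<Prod>s\<leftarrow>ss. s + 1)"
      have prod_z: "x * (z + 1) = 3 ^ (k - 2) * 2 ^ r"
        using arg_cong[OF ssz, of "\<lambda>xs. \<Prod>s\<leftarrow>xs. s + 1"] by (simp add: x_def numeral_2_eq_2[symmetric])
      have sum_z: "(\<Sum>s\<leftarrow>ss. 2 * s - 1) + (2 * z - 1) = 3 * (k - 2) + r"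
        using arg_cong[OF ssz, of "\<lambda>xs. \<Sum>s\<leftarrow>xs. 2 * s - 1"] by (simp add: sum_list_replicate)
      have le: "wtrees verts edges f + (3 * p + q)
        \<le> 6 * (x * (z + 1)) + 4 * x + 4 * (z + 1) + 2 + 3 * (k - 2) + r"
        by (rule cycle_bound_two[OF f1 f2 f3 DD k k2 r prod prod_z]) (use z in auto)
      have "6 * (x * (z + 1)) + 4 * x + 4 * (z + 1) + 2 + 3 * (k - 2) + r + 1
        = num_subtrees (Uab_V 2 2 ss [z]) (Uab_E 2 2 ss [z])"
      proof -
        have "z = 1 \<or> z = 2" using z by simp
        note num_subtrees_Uab[of 2 2 z ss, OF refl disjI2[OF refl] this ss_set]
        then show ?thesis unfolding x_def[symmetric] wtrees_Uab_22 using sum_z by linarith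
      qed
      then show ?thesis unfolding ll ss_def[symmetric] z_def[symmetric] using bound le by linarith
    qed
  next
    assume h: "l ! 0 = 1 \<and> 6 \<le> length l"
    then have "l ! 0 = 1" by blast
    then have k0: "k = 0" using nths(1) by (cases "k = 0") simp_all
    then have c0: "card (verts \<inter> D) = 0" and p0: "p = 0" using k by linarith+
    have "finite (verts \<inter> D)" by (simp add: verts_def)
    then have nD: "verts \<inter> D = {}" using c0 card_0_eq by blast
    have mr: "length l = r" using m k0 by simp
    have le: "wtrees verts edges f + q \<le> 17 * 2 ^ (r - 5) + r + 5"
    proof (rule cycle_bound_zero)
      show "2 \<le> f v" if "v \<in> verts" for v using f2[of v] that nD by blast
      show "(\<Prod>v\<in>verts. f v) = 2 ^ q" using prod p0 by simp
      show "r = n + q" using card_free_edges[OF DD] r c0 by linarith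
      show "6 \<le> r" using h mr by linarith
    qed
    have "5 \<le> r" using h mr by linarith
    then show "num_subtrees V E \<le> num_subtrees (U1_V (length l)) (U1_E (length l))"
      unfolding mr using bound p0 le num_subtrees_U1[of r] by linarith
  qed
qed

end
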